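(* Let $(G,V,E)$ be a tree with vertex set $V$ and edge set $E$. Then for all $n,i\ge 0$: (1) $H_i(\mathrm{Conf}_n^{\mathrm{sink}}(G,V))$ is torsion free; (2) the homological dimension of $\mathrm{Conf}_n^{\mathrm{sink}}(G,V)$ is given by $\mathrm{hdim}(\mathrm{Conf}_n^{\mathrm{sink}}(G,V))=\min\{\lfloor n/2\rfloor,|E|\}$; (3) the group $H_i(\mathrm{Conf}_n^{\mathrm{sink}}(G,V))$ depends, up to isomorphism, only on $i$, $n$ and $|E|$.
   Context: A graph $(G,V,E)$ is a compact connected CW complex $G$ of dimension one together with its set $V$ of 0-cells (vertices) and its set $E$ of 1-cells (edges). A tree is a graph $(G,V,E)$ with $G$ contractible. The $n$-th sink configuration space is $\mathrm{Conf}_n^{\mathrm{sink}}(G,V)=\{(x_1,\dots,x_n)\in G^n \mid \text{for all } i\neq j:\ x_i\neq x_j \text{ or } x_i=x_j\in V\}$, with the subspace topology from $G^n$. Homology is singular homology with integer coefficients. The homological dimension $\mathrm{hdim}(Y)$ of a space $Y$ is the largest $i$ with $H_i(Y)\neq 0$. *)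

theory Defs
  imports "HOL-Analysis.Analysis" "HOL-Homology.Homology"
begin

text \<open>A CW structure of dimension at most one on \<open>X\<close>, given intrinsically: a set \<open>V\<close> of 0-cells
  (points) and a set \<open>E\<close> of \<^emph>\<open>open\<close> 1-cells (subsets of \<open>X\<close>). Closure-finiteness is automatic,
  since a characteristic map sends the two end points of the interval into \<open>V\<close>; as \<open>X\<close> is Hausdorff,
  \<open>X closure_of e\<close> is the image of the characteristic map of \<open>e\<close>, so the last conjunct is the weak
  topology. It also makes \<open>V\<close> discrete.\<close>

definition characteristic_map :: "'a topology \<Rightarrow> 'a set \<Rightarrow> 'a set \<Rightarrow> (real \<Rightarrow> 'a) \<Rightarrow> bool" where
  "characteristic_map X V e \<phi> \<longleftrightarrow>
     continuous_map (top_of_set {0..1}) X \<phi> \<and>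
     homeomorphic_map (top_of_set {0<..<1}) (subtopology X e) \<phi> \<and>
     \<phi> 0 \<in> V \<and> \<phi> 1 \<in> V"

definition CW_complex_1 :: "'a topology \<Rightarrow> 'a set \<Rightarrow> 'a set set \<Rightarrow> bool" where
  "CW_complex_1 X V E \<longleftrightarrow>
     Hausdorff_space X \<and>
     V \<union> \<Union>E = topspace X \<and> V \<inter> \<Union>E = {} \<and> pairwise disjnt E \<and>
     (\<forall>e\<in>E. \<exists>\<phi>. characteristic_map X V e \<phi>) \<and>
     (\<forall>A \<subseteq> topspace X. (\<forall>e\<in>E. closedin X (A \<inter> X closure_of e)) \<longrightarrow> closedin X A)"

text \<open>\<open>connected_space\<close> and \<open>contractible_space\<close> both hold of the empty space, so non-emptiness is
  required separately. The one-point graph, with \<open>E = {}\<close>, is allowed.\<close>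

definition CW_graph :: "'a topology \<Rightarrow> 'a set \<Rightarrow> 'a set set \<Rightarrow> bool" where
  "CW_graph X V E \<longleftrightarrow>
     CW_complex_1 X V E \<and> compact_space X \<and> connected_space X \<and> topspace X \<noteq> {}"

definition CW_tree :: "'a topology \<Rightarrow> 'a set \<Rightarrow> 'a set set \<Rightarrow> bool" where
  "CW_tree X V E \<longleftrightarrow> CW_graph X V E \<and> contractible_space X"

text \<open>Points of \<open>X\<^sup>n\<close> are the extensional functions on \<open>{..<n}\<close>.\<close>

definition sink_conf :: "nat \<Rightarrow> 'a topology \<Rightarrow> 'a set \<Rightarrow> (nat \<Rightarrow> 'a) topology" where
  "sink_conf n X V =
     subtopology (product_topology (\<lambda>_. X) {..<n})
       {x. \<forall>i<n. \<forall>j<n. i \<noteq> j \<longrightarrow> x i \<noteq> x j \<or> (x i = x j \<and> x i \<in> V)}"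

definition torsion_free :: "('a, 'b) monoid_scheme \<Rightarrow> bool" where
  "torsion_free G \<longleftrightarrow>
     (\<forall>x \<in> carrier G. \<forall>k::nat. k > 0 \<longrightarrow> x [^]\<^bsub>G\<^esub> k = \<one>\<^bsub>G\<^esub> \<longrightarrow> x = \<one>\<^bsub>G\<^esub>)"

text \<open>A relation rather than a function, since the largest degree need not exist for an arbitrary
  space.\<close>

definition has_hdim :: "'a topology \<Rightarrow> nat \<Rightarrow> bool" where
  "has_hdim Y d \<longleftrightarrow>
     \<not> trivial_group (homology_group (int d) Y) \<and>
     (\<forall>i. \<not> trivial_group (homology_group (int i) Y) \<longrightarrow> i \<le> d)"

end

theory Submission
  imports Defs
begin

text \<open>
  The homology of the configuration space is computed by removing the edges of the tree one at a
  time. It is free abelian, of a rank given by a recursion (\<open>conf_rank\<close>) that sees only the number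
  of edges and the set of labels; all three claims are read off from this rank.

  Let \<open>X\<close> be a tree with a pendant edge \<open>\<psi> : [0,1] \<rightarrow> X\<close>, attached to the subtree \<open>A\<close> at \<open>\<psi> 0\<close>,
  and let \<open>C I\<close> be the space of configurations in \<open>X\<close> labelled by a finite set \<open>I\<close> of numbers. Every
  label \<open>i\<close> has a coordinate along the edge, which is \<open>0\<close> as long as \<open>i\<close> stays in \<open>A\<close>. Since all
  vertices are sinks, labels may pile up at \<open>\<psi> 0\<close> and \<open>\<psi> 1\<close>, but inside the edge they are distinct.
  Up to homotopy \<open>C I\<close> is a cube graph of spaces: over a set \<open>T\<close> of labels sitting at the leaf \<open>\<psi> 1\<close>
  lives the configuration space of \<open>A\<close> with labels \<open>I - T\<close>, and over the edge of the cube that carries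
  label \<open>i\<close> from \<open>\<psi> 0\<close> to \<open>\<psi> 1\<close> lives a cylinder on the configuration space of \<open>A\<close> with labels
  \<open>I - T - {i}\<close>.

  The edges of the cube along which the smallest label leaves the leaf form a spanning tree. Cutting
  the other cylinders in the middle, that is, removing the \<open>wall\<close> of configurations in which some label
  is at coordinate \<open>1/2\<close> while a smaller one is further out, leaves a space that contracts to the
  configurations inside \<open>A\<close> (\<open>wall_complement_contracts\<close>): the labels go back to \<open>\<psi> 0\<close> in increasing
  order. These configurations are a retract of \<open>C I\<close>, so the long exact sequence of the pair splits,
  and excision turns the relative term into the homology, one degree lower, of one side of the wall
  (\<open>homology_handle_attachment\<close>). That side is a disjoint union of slabs, indexed by the \<open>handles\<close>
  \<open>(i, T)\<close>, each homotopy equivalent to a configuration space of \<open>A\<close> with labels \<open>I - T - {i}\<close>.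
  Hence
  \<open>H\<^sub>p(C I) = H\<^sub>p(conf I A) \<oplus> (\<Oplus>(i, T). H\<^bsub>p-1\<^esub>(conf (I - T - {i}) A))\<close>,
  which is \<open>free_of_rank_homology_conf\<close>. As a handle uses up at least two labels and one edge, the rank
  in degree \<open>d\<close> is positive exactly up to \<open>min (n div 2) |E|\<close> (\<open>conf_rank_pos_iff\<close>).

  It remains to find a pendant edge. If the complement of an open edge were connected, collapsing it
  would give a map to the circle that has no continuous logarithm, although every map from a compact
  contractible space to the circle has one. So every edge separates the tree into two connected
  pieces, and an edge with the fewest edges on one side is pendant (\<open>leaf_exists\<close>).
\<close>

section \<open>Free abelian groups of finite rank\<close>

definition free_of_rank :: "('a, 'b) monoid_scheme \<Rightarrow> nat \<Rightarrow> bool" where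
  "free_of_rank G r \<longleftrightarrow> G \<cong> free_Abelian_group {..<r}"

lemma free_Abelian_group_finite_rank:
  "finite S \<Longrightarrow> free_of_rank (free_Abelian_group S) (card S)"
  unfolding free_of_rank_def isomorphic_free_Abelian_groups
  by (simp add: eqpoll_iff_card)

lemma free_of_rank_iso:
  assumes "G \<cong> H" "free_of_rank H r"
  shows "free_of_rank G r"
  using assms iso_trans unfolding free_of_rank_def by blast

lemma free_of_rank_unique_iso:
  assumes "free_of_rank G r" "free_of_rank H r" "group H"
  shows "G \<cong> H"
  using assms iso_trans group.iso_sym unfolding free_of_rank_def by blast

lemma DirProd_free_Abelian_group:
  assumes "S \<inter> T = {}"
  shows "free_Abelian_group S \<times>\<times> free_Abelian_group T \<cong> free_Abelian_group (S \<union> T)"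
proof -
  let ?h = "\<lambda>(x, y). x + y"
  have "?h \<in> hom (free_Abelian_group S \<times>\<times> free_Abelian_group T) (free_Abelian_group (S \<union> T))"
    using keys_add by (fastforce simp: hom_def)
  moreover have "inj_on ?h (carrier (free_Abelian_group S \<times>\<times> free_Abelian_group T))"
  proof (rule inj_onI, clarsimp)
    fix x y x' y' :: "'a \<Rightarrow>\<^sub>0 int"
    assume k: "Poly_Mapping.keys x \<subseteq> S" "Poly_Mapping.keys y \<subseteq> T"
       "Poly_Mapping.keys x' \<subseteq> S" "Poly_Mapping.keys y' \<subseteq> T" and eq: "x + y = x' + y'"
    then have "x - x' = y' - y"
      by (simp add: algebra_simps)
    moreover have "Poly_Mapping.keys (x - x') \<subseteq> S" "Poly_Mapping.keys (y' - y) \<subseteq> T"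
      using k keys_diff[of x x'] keys_diff[of y' y] by auto
    ultimately have "Poly_Mapping.keys (x - x') \<subseteq> S \<inter> T"
      by simp
    then have "Poly_Mapping.keys (x - x') = {}"
      using assms by auto
    then show "x = x' \<and> y = y'"
      using eq by simp
  qed
  moreover have "z \<in> ?h ` carrier (free_Abelian_group S \<times>\<times> free_Abelian_group T)"
    if "Poly_Mapping.keys z \<subseteq> S \<union> T" for z
  proof (rule free_Abelian_group_induct[OF that], goal_cases)
    case 1
    show ?case
      by (intro image_eqI[where x="(0, 0)"]) auto
  next
    case (2 x y)
    then obtain a b c d where "x = a + b" "y = c + d"
      "Poly_Mapping.keys a \<subseteq> S" "Poly_Mapping.keys b \<subseteq> T" "Poly_Mapping.keys c \<subseteq> S" "Poly_Mapping.keys d \<subseteq> T"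
      by auto
    then have "x - y = ?h (a - c, b - d)" "Poly_Mapping.keys (a - c) \<subseteq> S" "Poly_Mapping.keys (b - d) \<subseteq> T"
      using keys_diff[of a c] keys_diff[of b d] by auto
    then show ?case
      by (intro image_eqI) auto
  next
    case (3 a)
    then show ?case
    proof
      assume "a \<in> S" then show ?thesis
        by (intro image_eqI[where x="(frag_of a, 0)"]) auto
    next
      assume "a \<in> T" then show ?thesis
        by (intro image_eqI[where x="(0, frag_of a)"]) auto
    qed
  qed
  ultimately have "?h \<in> iso (free_Abelian_group S \<times>\<times> free_Abelian_group T) (free_Abelian_group (S \<union> T))"
    using subsetD[OF keys_add] unfolding iso_def bij_betw_def hom_def
    by (fastforce simp: subset_iff image_subset_iff)
  then show ?thesis
    by (rule is_isoI)
qed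

lemma free_of_rank_DirProd:
  assumes "free_of_rank G r" "free_of_rank H s" "group G"
  shows "free_of_rank (G \<times>\<times> H) (r + s)"
proof -
  have "free_Abelian_group {..<s} \<cong> free_Abelian_group {r..<r+s}"
    by (simp add: isomorphic_free_Abelian_groups eqpoll_iff_card)
  then have "H \<cong> free_Abelian_group {r..<r+s}"
    using assms(2) iso_trans unfolding free_of_rank_def by blast
  then have "G \<times>\<times> H \<cong> free_Abelian_group {..<r} \<times>\<times> free_Abelian_group {r..<r+s}"
    using assms(1) unfolding free_of_rank_def by (intro group.DirProd_iso_trans[OF assms(3)])
  also have "\<dots> \<cong> free_Abelian_group ({..<r} \<union> {r..<r+s})"
    by (rule DirProd_free_Abelian_group) auto
  also have "{..<r} \<union> {r..<r+s} = {..<r+s}"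
    by auto
  finally show ?thesis
    by (simp add: free_of_rank_def)
qed

lemma free_of_rank_sum_group:
  assumes "finite I" and "\<And>i. i \<in> I \<Longrightarrow> free_of_rank (G i) (r i)" and "\<And>i. i \<in> I \<Longrightarrow> group (G i)"
  shows "free_of_rank (sum_group I G) (\<Sum>i\<in>I. r i)"
proof -
  let ?S = "\<lambda>i. {i} \<times> {..<r i}"
  have "G i \<cong> free_Abelian_group (?S i)" if "i \<in> I" for i
  proof -
    have "free_Abelian_group {..<r i} \<cong> free_Abelian_group (?S i)"
      by (simp add: isomorphic_free_Abelian_groups eqpoll_iff_card)
    then show ?thesis
      using assms(2)[OF that] iso_trans unfolding free_of_rank_def by blast
  qed
  then have "sum_group I G \<cong> sum_group I (\<lambda>i. free_Abelian_group (?S i))"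
    using assms by (intro iso_sum_groupI) auto
  also have "\<dots> \<cong> free_Abelian_group (\<Union>(?S ` I))"
    by (rule is_isoI, rule iso_free_Abelian_group_sum) (auto simp: pairwise_def disjnt_def)
  finally have "sum_group I G \<cong> free_Abelian_group (\<Union>(?S ` I))" .
  moreover have "card (\<Union>(?S ` I)) = (\<Sum>i\<in>I. r i)"
    using assms(1) by (subst card_UN_disjoint) auto
  moreover have "finite (\<Union>(?S ` I))"
    using assms(1) by auto
  ultimately show ?thesis
    using free_of_rank_iso free_Abelian_group_finite_rank by metis
qed

lemma torsion_free_free_of_rank:
  assumes "free_of_rank G r" "group G"
  shows "torsion_free G"
  unfolding torsion_free_def
proof (intro ballI allI impI)
  fix x and k :: nat
  assume x: "x \<in> carrier G" and k: "k > 0" and pow: "x [^]\<^bsub>G\<^esub> k = \<one>\<^bsub>G\<^esub>"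
  obtain h where h: "h \<in> iso G (free_Abelian_group {..<r})"
    using assms(1) unfolding free_of_rank_def is_iso_def by auto
  then interpret h: group_hom G "free_Abelian_group {..<r}" h
    using assms(2) by (simp add: group_hom_def group_hom_axioms_def iso_def)
  have "frag_cmul (int k) (h x) = 0"
    using h.hom_nat_pow[OF x, of k] h.hom_one by (simp add: pow)
  then have "h x = 0"
    using k by simp
  then have "h x = h \<one>\<^bsub>G\<^esub>"
    using h.hom_one by simp
  moreover have "inj_on h (carrier G)"
    using h by (simp add: iso_def bij_betw_def)
  ultimately show "x = \<one>\<^bsub>G\<^esub>"
    using x by (simp add: inj_onD)
qed

lemma trivial_group_free_of_rank_iff:
  assumes "free_of_rank G r" "group G"
  shows "trivial_group G \<longleftrightarrow> r = 0"
proof -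
  have "trivial_group G \<longleftrightarrow> trivial_group (free_Abelian_group {..<r})"
    using assms isomorphic_group_triviality group_free_Abelian_group unfolding free_of_rank_def by blast
  also have "\<dots> \<longleftrightarrow> r = 0"
  proof
    assume "trivial_group (free_Abelian_group {..<r})"
    then have "carrier (free_Abelian_group {..<r}) = {0}"
      by (simp add: trivial_group_def)
    moreover have "frag_of 0 \<in> carrier (free_Abelian_group {..<r})" if "r > 0"
      using that by (simp only: frag_of_in_free_Abelian_group lessThan_iff)
    ultimately show "r = 0"
      by (metis frag_of_nonzero gr_zeroI singletonD)
  next
    assume "r = 0"
    then have "carrier (free_Abelian_group {..<r}) = {\<one>\<^bsub>free_Abelian_group {..<r}\<^esub>}"
      by (auto simp: free_Abelian_group_def)
    then show "trivial_group (free_Abelian_group {..<r})"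
      unfolding trivial_group_def using group_free_Abelian_group by blast
  qed
  finally show ?thesis .
qed

lemma free_of_rank_trivial:
  assumes "trivial_group G" shows "free_of_rank G 0"
proof -
  have "(\<lambda>_. 0) \<in> iso G (free_Abelian_group {..<0::nat})"
    using assms by (auto simp: trivial_group_def iso_def hom_def bij_betw_def inj_on_def free_Abelian_group_def)
  then show ?thesis
    unfolding free_of_rank_def by (rule is_isoI)
qed

lemma free_of_rank_integer:
  assumes "G \<cong> integer_group" shows "free_of_rank G 1"
proof -
  have "{..<1} = {0::nat}" by auto
  then show ?thesis
    using assms isomorphic_group_integer_free_Abelian_group_singleton iso_trans
    unfolding free_of_rank_def by metis
qed

section \<open>Attaching handles\<close>

text \<open>
  \<open>X\<close> is obtained from \<open>U = X - Z\<close> by gluing in the neighbourhood \<open>N\<close> of \<open>Z\<close>, which is cut by \<open>Z\<close> into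
  the sides \<open>P\<close> and \<open>M\<close>. As \<open>S\<close> is a retract of \<open>X\<close> and carries the homology of \<open>U\<close>,
  \<open>H(X) = H(S) \<oplus> H(X, U)\<close>. Excising the complement of \<open>N\<close> gives \<open>H(X, U) = H(N, P \<union> M)\<close>; the exact
  sequence of the triple \<open>(N, P \<union> M, P)\<close>, where \<open>H(N, P)\<close> vanishes because \<open>g\<close> contracts \<open>N\<close> into one
  side, lowers the degree: it is \<open>H(P \<union> M, P)\<close>. Excising \<open>P\<close> leaves \<open>H(M)\<close>.
\<close>
lemma homology_handle_attachment:
  assumes ret: "S retract_of_space X"
    and Z: "closedin X Z" "S \<inter> Z = {}"
    and def1: "continuous_map (subtopology X (topspace X - Z)) (subtopology X S) f"
      "\<And>x. x \<in> S \<Longrightarrow> f x = x"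
      "homotopic_with (\<lambda>h. True) (subtopology X (topspace X - Z)) (subtopology X (topspace X - Z)) f id"
    and N: "openin X N" "Z \<subseteq> N"
    and PM: "openin X P" "openin X M" "P \<inter> M = {}" "P \<union> M = N - Z"
    and def2: "continuous_map (subtopology X N) (subtopology X P) g"
      "homotopic_with (\<lambda>h. True) (subtopology X P) (subtopology X P) g id"
      "homotopic_with (\<lambda>h. True) (subtopology X N) (subtopology X N) g id"
  shows "homology_group p X \<cong> homology_group p (subtopology X S) \<times>\<times> homology_group (p - 1) (subtopology X M)"
proof -
  define U where "U = topspace X - Z"
  have SX: "S \<subseteq> topspace X" and SU: "S \<subseteq> U" and NX: "N \<subseteq> topspace X" and UX: "U \<subseteq> topspace X"
    and PX: "P \<subseteq> N" and MN: "M \<subseteq> N"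
    using ret Z openin_subset[OF N(1)] PM by (auto simp: retract_of_space_def U_def)
  have sub: "subtopology (subtopology X A) B = subtopology X B" if "B \<subseteq> A" for A B :: "'a set"
    using that by (simp add: subtopology_subtopology inf_absorb2)
  have t1: "trivial_group (relative_homology_group q (subtopology X U) S)" for q
  proof (rule trivial_relative_homology_group_gen[where f=f])
    show "continuous_map (subtopology X U) (subtopology (subtopology X U) S) f"
      using def1(1) SU by (simp add: sub U_def)
    show "homotopic_with (\<lambda>h. True) (subtopology (subtopology X U) S) (subtopology (subtopology X U) S) f id"
      using SU by (intro homotopic_with_equal)
        (auto simp: sub def1(2) intro: continuous_map_eq[where f=id])
    show "homotopic_with (\<lambda>k. True) (subtopology X U) (subtopology X U) f id"
      using def1(3) by (simp add: U_def)
  qed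
  have t2: "trivial_group (relative_homology_group q (subtopology X N) P)" for q
    using def2 PX by (intro trivial_relative_homology_group_gen[where f=g]) (auto simp: sub)
  have 1: "homology_group p X \<cong> homology_group p (subtopology X S) \<times>\<times> relative_homology_group p X S"
    using ret by (intro isomorphic_group_homology_group_prod_retract) auto
  have 2: "relative_homology_group p X S \<cong> relative_homology_group p X U"
  proof -
    have "exact_seq ([relative_homology_group p X U, relative_homology_group p X S,
                     relative_homology_group p (subtopology X U) S],
                    [hom_induced p X S X U id, hom_induced p (subtopology X U) S X S id])"
      by (rule homology_exactness_triple_3[OF SU])
    moreover have "exact_seq ([relative_homology_group(p-1) (subtopology X U) S,
                     relative_homology_group p X U,
                     relative_homology_group p X S],
                    [hom_relboundary p X U S, hom_induced p X S X U id])"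
      by (rule homology_exactness_triple_1[OF SU])
    ultimately have "exact_seq ([relative_homology_group(p-1) (subtopology X U) S,
                     relative_homology_group p X U, relative_homology_group p X S,
                     relative_homology_group p (subtopology X U) S],
                    [hom_relboundary p X U S, hom_induced p X S X U id, hom_induced p (subtopology X U) S X S id])"
      by simp
    then show ?thesis
      using very_short_exact_sequence[OF _ t1 t1] is_isoI by blast
  qed
  have 3: "relative_homology_group p (subtopology X N) (P \<union> M) \<cong> relative_homology_group p X U"
  proof -
    have cl: "X closure_of (topspace X - N) = topspace X - N"
      using N by (simp add: closure_of_eq closedin_diff)
    have op: "X interior_of U = U"
      using Z by (simp add: U_def interior_of_eq openin_diff)
    have "X closure_of (topspace X - N) \<subseteq> X interior_of U"
      unfolding cl op using N by (auto simp: U_def)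
    from homology_excision_axiom[OF this UX, of p] have
      "relative_homology_group p (subtopology X (topspace X - (topspace X - N))) (U - (topspace X - N))
       \<cong> relative_homology_group p (subtopology X (topspace X)) U"
      by (rule is_isoI)
    moreover have "topspace X - (topspace X - N) = N" "U - (topspace X - N) = P \<union> M"
      using NX PM by (auto simp: U_def)
    ultimately show ?thesis by simp
  qed
  have 4: "relative_homology_group p (subtopology X N) (P \<union> M)
       \<cong> relative_homology_group (p - 1) (subtopology X (P \<union> M)) P"
  proof -
    have PPM: "P \<subseteq> P \<union> M" by simp
    have s: "subtopology (subtopology X N) (P \<union> M) = subtopology X (P \<union> M)"
      using PM by (intro sub) auto
    have "exact_seq ([relative_homology_group (p-1) (subtopology X N) P,
                     relative_homology_group (p-1) (subtopology X (P \<union> M)) P,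
                     relative_homology_group p (subtopology X N) (P \<union> M)],
                    [hom_induced (p-1) (subtopology X (P \<union> M)) P (subtopology X N) P id,
                     hom_relboundary p (subtopology X N) (P \<union> M) P])"
      using homology_exactness_triple_2[OF PPM, of p "subtopology X N"] unfolding s .
    moreover have "exact_seq ([relative_homology_group (p-1) (subtopology X (P \<union> M)) P,
                     relative_homology_group p (subtopology X N) (P \<union> M),
                     relative_homology_group p (subtopology X N) P],
                    [hom_relboundary p (subtopology X N) (P \<union> M) P,
                      hom_induced p (subtopology X N) P (subtopology X N) (P \<union> M) id])"
      using homology_exactness_triple_1[OF PPM, of p "subtopology X N"] unfolding s .
    ultimately have "exact_seq ([relative_homology_group (p-1) (subtopology X N) P,
         relative_homology_group (p-1) (subtopology X (P \<union> M)) P,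
         relative_homology_group p (subtopology X N) (P \<union> M),
         relative_homology_group p (subtopology X N) P],
        [hom_induced (p-1) (subtopology X (P \<union> M)) P (subtopology X N) P id,
         hom_relboundary p (subtopology X N) (P \<union> M) P,
         hom_induced p (subtopology X N) P (subtopology X N) (P \<union> M) id])"
      by simp
    then show ?thesis
      using very_short_exact_sequence[OF _ t2 t2] is_isoI by blast
  qed
  have 5: "homology_group (p - 1) (subtopology X M) \<cong> relative_homology_group (p - 1) (subtopology X (P \<union> M)) P"
  proof -
    let ?Y = "subtopology X (P \<union> M)"
    have tY: "topspace ?Y = P \<union> M"
      using openin_subset[OF PM(1)] openin_subset[OF PM(2)] by auto
    have "openin ?Y M" "openin ?Y P"
      using PM by (auto simp: openin_subtopology_alt intro!: openin_subset_topspace_eq)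
    moreover have "P = topspace ?Y - M"
      using PM(3) tY by auto
    ultimately have "closedin ?Y P"
      by (metis closedin_diff closedin_topspace)
    then have "?Y closure_of P \<subseteq> ?Y interior_of P"
      using \<open>openin ?Y P\<close> by (metis closure_of_eq interior_of_eq order_refl)
    from homology_excision_axiom[OF this, of "P \<union> M" "p - 1"] have
      "relative_homology_group (p-1) (subtopology ?Y (P \<union> M - P)) (P - P)
       \<cong> relative_homology_group (p-1) (subtopology ?Y (P \<union> M)) P"
      by (auto intro: is_isoI)
    moreover have "P \<union> M - P = M"
      using PM by auto
    ultimately show ?thesis
      by (simp add: sub)
  qed
  have "relative_homology_group p X S \<cong> homology_group (p - 1) (subtopology X M)"
    using 2 3 4 5 iso_trans group.iso_sym group_relative_homology_group by meson
  then show ?thesis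
    using 1 iso_trans group.DirProd_iso_trans[OF group_relative_homology_group iso_refl] by blast
qed

section \<open>Auxiliary topology\<close>

lemma openin_Collect_less:
  assumes "continuous_map X euclideanreal f" "continuous_map X euclideanreal g"
  shows "openin X {x \<in> topspace X. f x < g x}"
proof -
  have "openin X {x \<in> topspace X. g x - f x \<in> {0<..}}"
    by (rule openin_continuous_map_preimage[of _ euclideanreal]) (use assms in \<open>auto intro: continuous_intros\<close>)
  then show ?thesis by simp
qed

lemma closedin_Collect_le:
  assumes "continuous_map X euclideanreal f" "continuous_map X euclideanreal g"
  shows "closedin X {x \<in> topspace X. f x \<le> g x}"
proof -
  have "closedin X {x \<in> topspace X. g x - f x \<in> {0..}}"
    by (rule closedin_continuous_map_preimage[of _ euclideanreal]) (use assms in \<open>auto intro: continuous_intros\<close>)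
  then show ?thesis by simp
qed

lemma openin_Collect_ball:
  assumes "finite K" "\<And>k. k \<in> K \<Longrightarrow> openin X {x \<in> topspace X. P k x}"
  shows "openin X {x \<in> topspace X. \<forall>k\<in>K. P k x}"
  using assms
proof (induction K)
  case (insert a K)
  have "{x \<in> topspace X. \<forall>k\<in>insert a K. P k x} = {x \<in> topspace X. P a x} \<inter> {x \<in> topspace X. \<forall>k\<in>K. P k x}"
    by auto
  with insert show ?case by auto
qed auto

text \<open>
  The domain of a homotopy on a disjoint union of open sets is again such a union, so homotopies on
  the parts fit together without any compatibility condition.
\<close>
lemma homotopic_with_disjoint_union:
  assumes ope: "\<And>a. a \<in> K \<Longrightarrow> openin X (N a)"
    and disj: "\<And>a b. a \<in> K \<Longrightarrow> b \<in> K \<Longrightarrow> a \<noteq> b \<Longrightarrow> N a \<inter> N b = {}"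
    and hom: "\<And>a. a \<in> K \<Longrightarrow> homotopic_with (\<lambda>_. True) (subtopology X (N a)) Y f g"
  shows "homotopic_with (\<lambda>_. True) (subtopology X (\<Union>a\<in>K. N a)) Y f g"
proof -
  let ?I = "top_of_set {0..1::real}"
  have "\<exists>h. continuous_map (prod_topology ?I (subtopology X (N a))) Y h \<and> (\<forall>x. h (0, x) = f x) \<and> (\<forall>x. h (1, x) = g x)"
    if "a \<in> K" for a
    using hom[OF that] unfolding homotopic_with_def by blast
  then obtain h where h: "\<And>a. a \<in> K \<Longrightarrow> continuous_map (prod_topology ?I (subtopology X (N a))) Y (h a)"
    "\<And>a x. a \<in> K \<Longrightarrow> h a (0, x) = f x" "\<And>a x. a \<in> K \<Longrightarrow> h a (1, x) = g x"
    by metis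
  define idx where "idx x = (THE a. a \<in> K \<and> x \<in> N a)" for x
  have idx: "idx x = a" if "a \<in> K" "x \<in> N a" for a x
    unfolding idx_def using that disj by (intro the_equality) auto
  \<comment> \<open>Outside the union only the values at the two end times are prescribed.\<close>
  define H where "H = (\<lambda>(t, x). if x \<in> (\<Union>a\<in>K. N a) then h (idx x) (t, x) else if t = 0 then f x else g x)"
  have "continuous_map (prod_topology ?I (subtopology X (\<Union>a\<in>K. N a))) Y H"
  proof (rule pasting_lemma[where I=K and T="\<lambda>a. {0..1} \<times> N a" and f=h])
    fix a assume a: "a \<in> K"
    have "openin (subtopology X (\<Union>a\<in>K. N a)) (N a)"
      using ope[OF a] a by (auto simp: openin_subtopology intro!: exI[of _ "N a"])
    then show "openin (prod_topology ?I (subtopology X (\<Union>a\<in>K. N a))) ({0..1} \<times> N a)"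
      by (subst openin_prod_Times_iff) (auto simp: openin_subtopology_refl)
    have "subtopology (prod_topology ?I (subtopology X (\<Union>a\<in>K. N a))) ({0..1} \<times> N a)
        = prod_topology ?I (subtopology X (N a))"
      by (simp add: subtopology_Times[symmetric] prod_topology_subtopology subtopology_subtopology Times_Int_Times Int_assoc
          Int_absorb1[OF UN_upper[OF a, of N]])
    then show "continuous_map (subtopology (prod_topology ?I (subtopology X (\<Union>a\<in>K. N a))) ({0..1} \<times> N a)) Y (h a)"
      using h(1)[OF a] by simp
  next
    fix a b z assume "a \<in> K" "b \<in> K" 
      "z \<in> topspace (prod_topology ?I (subtopology X (\<Union>a\<in>K. N a))) \<inter> ({0..1} \<times> N a) \<inter> ({0..1} \<times> N b)"
    then show "h a z = h b z"
      using disj by (metis IntD1 IntD2 SigmaE2 disjoint_iff prod.collapse)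
  next
    fix z assume "z \<in> topspace (prod_topology ?I (subtopology X (\<Union>a\<in>K. N a)))"
    then obtain a where "a \<in> K" "snd z \<in> N a" "fst z \<in> {0..1}"
      by auto
    then show "\<exists>j. j \<in> K \<and> z \<in> {0..1} \<times> N j \<and> H z = h j z"
      by (intro exI[of _ a]) (auto simp: H_def idx split: prod.splits)
  qed
  moreover have "H (0, x) = f x" "H (1, x) = g x" for x
    using h(2,3) idx by (auto simp: H_def)
  ultimately show ?thesis
    unfolding homotopic_with_def by auto
qed

section \<open>Configurations on a tree with a pendant edge\<close>

text \<open>
  Labels from an arbitrary set \<open>I\<close> instead of an initial segment: removing labels in the recursion
  then needs no renumbering.
\<close>
definition conf :: "nat set \<Rightarrow> 'a topology \<Rightarrow> 'a set \<Rightarrow> (nat \<Rightarrow> 'a) topology" where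
  "conf I X V = subtopology (product_topology (\<lambda>_. X) I)
     {x. \<forall>i\<in>I. \<forall>j\<in>I. i \<noteq> j \<longrightarrow> x i = x j \<longrightarrow> x i \<in> V}"

lemma sink_conf_eq_conf: "sink_conf n X V = conf {..<n} X V"
proof -
  have "{x. \<forall>i<n. \<forall>j<n. i \<noteq> j \<longrightarrow> x i \<noteq> x j \<or> (x i = x j \<and> x i \<in> V)} =
      {x. \<forall>i\<in>{..<n}. \<forall>j\<in>{..<n}. i \<noteq> j \<longrightarrow> x i = x j \<longrightarrow> x i \<in> V}"
    by auto
  then show ?thesis
    unfolding sink_conf_def conf_def by simp
qed

lemma topspace_conf:
  "x \<in> topspace (conf I X V) \<longleftrightarrow>
     x \<in> (\<Pi>\<^sub>E i\<in>I. topspace X) \<and> (\<forall>i\<in>I. \<forall>j\<in>I. i \<noteq> j \<longrightarrow> x i = x j \<longrightarrow> x i \<in> V)"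
  by (auto simp: conf_def)

lemma continuous_map_conf_coordinate:
  "i \<in> I \<Longrightarrow> continuous_map (conf I X V) X (\<lambda>x. x i)"
  unfolding conf_def by (intro continuous_map_from_subtopology continuous_map_product_projection)

lemma continuous_map_into_conf:
  assumes "\<And>i. i \<in> I \<Longrightarrow> continuous_map D X (\<lambda>d. f d i)"
    and "\<And>d. d \<in> topspace D \<Longrightarrow> f d \<in> topspace (conf I X V)"
  shows "continuous_map D (conf I X V) f"
proof -
  have "f \<in> topspace D \<rightarrow> extensional I"
    using assms(2) by (auto simp: topspace_conf PiE_def)
  then have "continuous_map D (product_topology (\<lambda>_. X) I) f"
    using assms(1) by (auto simp: continuous_map_componentwise)
  then show ?thesis
    using assms(2) unfolding conf_def by (auto simp: continuous_map_in_subtopology)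
qed

lemma conf_subtopology:
  "conf I (subtopology X A) V = subtopology (conf I X V) {x \<in> topspace (conf I X V). \<forall>i\<in>I. x i \<in> A}"
proof -
  let ?P = "product_topology (\<lambda>_. X) I"
  let ?D = "{x. \<forall>i\<in>I. \<forall>j\<in>I. i \<noteq> j \<longrightarrow> x i = x j \<longrightarrow> x i \<in> V}"
  let ?B = "{x \<in> topspace (conf I X V). \<forall>i\<in>I. x i \<in> A}"
  have eq: "topspace ?P \<inter> (PiE I (\<lambda>_. A) \<inter> ?D) = topspace ?P \<inter> (?D \<inter> ?B)"
    by (auto simp: PiE_iff topspace_conf)
  have "conf I (subtopology X A) V = subtopology ?P (PiE I (\<lambda>_. A) \<inter> ?D)"
    unfolding conf_def subtopology_product_topology[symmetric] subtopology_subtopology ..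
  also have "\<dots> = subtopology ?P (?D \<inter> ?B)"
    by (rule arg_cong[OF eq, of "subtopology ?P", unfolded subtopology_restrict])
  also have "\<dots> = subtopology (conf I X V) ?B"
    unfolding conf_def[of I X V] subtopology_subtopology ..
  finally show ?thesis .
qed

text \<open>
  The space \<open>X\<close> is the closed subspace \<open>A\<close> with an arc \<open>\<psi>\<close> attached at \<open>\<psi> 0\<close>; both ends of the arc
  are sinks and no interior point is one.
\<close>
locale pendant_edge =
  fixes X :: "'a topology" and V A :: "'a set" and \<psi> :: "real \<Rightarrow> 'a"
  assumes Hausdorff: "Hausdorff_space X"
    and closed_A: "closedin X A"
    and cont_\<psi>: "continuous_map (top_of_set {0..1}) X \<psi>"
    and inj_\<psi>: "inj_on \<psi> {0..1}"
    and cover: "topspace X = A \<union> \<psi> ` {0..1}"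
    and meet: "A \<inter> \<psi> ` {0..1} = {\<psi> 0}"
    and ends: "V \<inter> \<psi> ` {0..1} = {\<psi> 0, \<psi> 1}"
begin

definition coord :: "'a \<Rightarrow> real" where
  "coord x = (if x \<in> A then 0 else inv_into {0..1} \<psi> x)"

text \<open>
  Moving a point along the edge to coordinate \<open>t\<close>. Points of \<open>A\<close> have nowhere to go, so this is
  continuous only as long as \<open>t\<close> vanishes on them.
\<close>
definition slide :: "'a \<Rightarrow> real \<Rightarrow> 'a" where
  "slide x t = (if x \<in> A then x else \<psi> t)"

lemma A_iff: "t \<in> {0..1} \<Longrightarrow> \<psi> t \<in> A \<longleftrightarrow> t = 0"
proof
  assume "t \<in> {0..1}" "\<psi> t \<in> A"
  then have "\<psi> t \<in> {\<psi> 0}"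
    unfolding meet[symmetric] by blast
  then show "t = 0"
    using inj_onD[OF inj_\<psi>, of t 0] \<open>t \<in> {0..1}\<close> by auto
qed (use meet in blast)

lemma coord_\<psi>: "t \<in> {0..1} \<Longrightarrow> coord (\<psi> t) = t"
  using A_iff inj_\<psi> by (simp add: coord_def)

lemma not_A_cases:
  assumes "x \<in> topspace X" "x \<notin> A"
  obtains t where "0 < t" "t \<le> 1" "x = \<psi> t" "coord x = t"
proof -
  obtain t where t: "t \<in> {0..1}" "x = \<psi> t"
    using assms cover by auto
  then have "t \<noteq> 0"
    using A_iff assms(2) by auto
  then show ?thesis
    using that[of t] t coord_\<psi> by auto
qed

lemma coord_bounds: "x \<in> topspace X \<Longrightarrow> 0 \<le> coord x \<and> coord x \<le> 1"
  by (metis coord_def dual_order.refl less_eq_real_def not_A_cases zero_less_one)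

lemma coord_0_iff: "x \<in> topspace X \<Longrightarrow> coord x = 0 \<longleftrightarrow> x \<in> A"
  by (metis coord_def less_irrefl not_A_cases)

lemma \<psi>_coord: "x \<in> topspace X \<Longrightarrow> x \<notin> A \<Longrightarrow> \<psi> (coord x) = x"
  by (metis not_A_cases)

lemma \<psi>_in_V_iff: "t \<in> {0..1} \<Longrightarrow> \<psi> t \<in> V \<longleftrightarrow> t = 0 \<or> t = 1"
proof
  assume "t \<in> {0..1}" "\<psi> t \<in> V"
  then have "\<psi> t \<in> {\<psi> 0, \<psi> 1}"
    unfolding ends[symmetric] by blast
  then show "t = 0 \<or> t = 1"
    using inj_onD[OF inj_\<psi>, of t 0] inj_onD[OF inj_\<psi>, of t 1] \<open>t \<in> {0..1}\<close> by auto
qed (use ends in blast)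

lemma \<psi>_topspace: "t \<in> {0..1} \<Longrightarrow> \<psi> t \<in> topspace X"
  using cover by auto

lemma closed_\<psi>_image: "closed C \<Longrightarrow> closedin X (\<psi> ` ({0..1} \<inter> C))"
proof -
  assume "closed C"
  then have "compactin (top_of_set {0..1}) ({0..1} \<inter> C)"
    by (simp add: compactin_subtopology compact_Int_closed)
  then have "compactin X (\<psi> ` ({0..1} \<inter> C))"
    using cont_\<psi> image_compactin by blast
  then show ?thesis
    using Hausdorff compactin_imp_closedin by blast
qed

text \<open>
  Preimages of closed sets are compact images under \<open>\<psi>\<close>, together with all of \<open>A\<close> if \<open>0\<close> is a value.
\<close>
lemma continuous_coord: "continuous_map X euclideanreal coord"
proof -
  have "closedin X {x \<in> topspace X. coord x \<in> C}" if "closed C" for C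
  proof -
    have "{x \<in> topspace X. coord x \<in> C} = (if 0 \<in> C then A else {}) \<union> \<psi> ` ({0..1} \<inter> C)"
    proof (intro subset_antisym subsetI)
      fix x assume x: "x \<in> {x \<in> topspace X. coord x \<in> C}"
      show "x \<in> (if 0 \<in> C then A else {}) \<union> \<psi> ` ({0..1} \<inter> C)"
      proof (cases "x \<in> A")
        case True then show ?thesis using x by (auto simp: coord_def)
      next
        case False
        with x obtain t where "0 < t" "t \<le> 1" "x = \<psi> t" "coord x = t"
          using not_A_cases by blast
        then show ?thesis using x by auto
      qed
    next
      fix x assume "x \<in> (if 0 \<in> C then A else {}) \<union> \<psi> ` ({0..1} \<inter> C)"
      then show "x \<in> {x \<in> topspace X. coord x \<in> C}"
        using cover by (auto simp: coord_\<psi> split: if_splits) (simp add: coord_def)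
    qed
    then show ?thesis
      using closed_A closed_\<psi>_image[OF that] by auto
  qed
  then show ?thesis
    by (auto simp: continuous_map_closedin)
qed

lemma slide_topspace: "x \<in> topspace X \<Longrightarrow> t \<in> {0..1} \<Longrightarrow> slide x t \<in> topspace X"
  using \<psi>_topspace by (auto simp: slide_def)

lemma coord_slide: "t \<in> {0..1} \<Longrightarrow> (x \<in> A \<Longrightarrow> t = 0) \<Longrightarrow> coord (slide x t) = t"
  using coord_\<psi>[of t] by (auto simp: slide_def coord_def[of x])

lemma slide_coord: "x \<in> topspace X \<Longrightarrow> slide x (coord x) = x"
  using \<psi>_coord by (auto simp: slide_def)

lemma continuous_slide:
  assumes f: "continuous_map D X f" and t: "continuous_map D euclideanreal t"
    and bounds: "\<And>d. d \<in> topspace D \<Longrightarrow> t d \<in> {0..1}"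
    and zero: "\<And>d. d \<in> topspace D \<Longrightarrow> f d \<in> A \<Longrightarrow> t d = 0"
  shows "continuous_map D X (\<lambda>d. slide (f d) (t d))"
proof (rule pasting_lemma_closed[where I=UNIV
      and T="\<lambda>b. {d \<in> topspace D. f d \<in> (if b then A else \<psi> ` {0..1})}"
      and f="\<lambda>b d. if b then f d else \<psi> (t d)"])
  fix b :: bool
  have "closedin X (\<psi> ` {0..1})"
    using closed_\<psi>_image[of UNIV] by simp
  then show "closedin D {d \<in> topspace D. f d \<in> (if b then A else \<psi> ` {0..1})}"
    using closed_A by (intro closedin_continuous_map_preimage[OF f]) auto
  have "continuous_map D (top_of_set {0..1}) t"
    using t bounds by (auto simp: continuous_map_in_subtopology)
  from continuous_map_compose[OF this cont_\<psi>] have "continuous_map D X (\<lambda>d. \<psi> (t d))"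
    by (simp add: o_def)
  then show "continuous_map (subtopology D {d \<in> topspace D. f d \<in> (if b then A else \<psi> ` {0..1})}) X
       (\<lambda>d. if b then f d else \<psi> (t d))"
    using f by (cases b) (auto intro: continuous_map_from_subtopology)
next
  have eq: "f d = \<psi> (t d)" if "d \<in> topspace D" "f d \<in> A" "f d \<in> \<psi> ` {0..1}" for d
    using that zero meet by force
  fix a b d assume "d \<in> topspace D \<inter> {d \<in> topspace D. f d \<in> (if a then A else \<psi> ` {0..1})} \<inter>
      {d \<in> topspace D. f d \<in> (if b then A else \<psi> ` {0..1})}"
  then show "(if a then f d else \<psi> (t d)) = (if b then f d else \<psi> (t d))"
    using eq by (auto split: if_splits)
next
  fix d assume "d \<in> topspace D"
  moreover then have "f d \<in> A \<union> \<psi> ` {0..1}"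
    using continuous_map_image_subset_topspace[OF f] cover by auto
  ultimately show "\<exists>j. j \<in> UNIV \<and> d \<in> {d \<in> topspace D. f d \<in> (if j then A else \<psi> ` {0..1})} \<and>
        slide (f d) (t d) = (if j then f d else \<psi> (t d))"
    by (intro exI[of _ "f d \<in> A"]) (auto simp: slide_def)
qed auto

abbreviation C :: "nat set \<Rightarrow> (nat \<Rightarrow> 'a) topology" where "C I \<equiv> conf I X V"

text \<open>
  A configuration is deformed by prescribing new edge coordinates for its labels; admissible
  coordinates keep the points of \<open>A\<close> fixed and avoid collisions inside the edge. All homotopies
  below are of this form, so they reduce to continuous families of numbers.
\<close>
definition move :: "nat set \<Rightarrow> (nat \<Rightarrow> 'a) \<Rightarrow> (nat \<Rightarrow> real) \<Rightarrow> nat \<Rightarrow> 'a" where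
  "move I x t = (\<lambda>i\<in>I. slide (x i) (t i))"

definition admissible :: "nat set \<Rightarrow> (nat \<Rightarrow> 'a) \<Rightarrow> (nat \<Rightarrow> real) \<Rightarrow> bool" where
  "admissible I x t \<longleftrightarrow> (\<forall>i\<in>I. 0 \<le> t i \<and> t i \<le> 1 \<and> (coord (x i) = 0 \<longrightarrow> t i = 0)) \<and>
     (\<forall>i\<in>I. \<forall>j\<in>I. i \<noteq> j \<longrightarrow> t i = t j \<longrightarrow> t i = 0 \<or> t i = 1)"

lemma C_topspaceD: "x \<in> topspace (C I) \<Longrightarrow> i \<in> I \<Longrightarrow> x i \<in> topspace X"
  by (auto simp: topspace_conf)

lemma C_coord_bounds: "x \<in> topspace (C I) \<Longrightarrow> i \<in> I \<Longrightarrow> 0 \<le> coord (x i) \<and> coord (x i) \<le> 1"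
  using C_topspaceD coord_bounds by blast

text \<open>
  Two labels off \<open>A\<close> with the same coordinate are at the same point, which must be a sink.
\<close>
lemma C_coord_collision:
  assumes "x \<in> topspace (C I)" "i \<in> I" "j \<in> I" "i \<noteq> j" "coord (x i) = coord (x j)"
  shows "coord (x i) = 0 \<or> coord (x i) = 1"
proof (cases "coord (x i) = 0")
  case False
  then have *: "x i \<notin> A" "x j \<notin> A"
    using assms by (auto simp: coord_def)
  then have "x i = x j"
    using assms \<psi>_coord C_topspaceD by metis
  then have "x i \<in> V"
    using assms by (auto simp: topspace_conf)
  then show ?thesis
    using * \<psi>_in_V_iff \<psi>_coord C_topspaceD coord_bounds assms(1,2)
    by (metis atLeastAtMost_iff)
qed auto

text \<open>
  Two slid points can only coincide at equal coordinates, hence at an end of the edge, which is a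
  sink, or when neither has moved.
\<close>
lemma move_topspace:
  assumes x: "x \<in> topspace (C I)" and t: "admissible I x t"
  shows "move I x t \<in> topspace (C I)"
proof -
  have "move I x t \<in> (\<Pi>\<^sub>E i\<in>I. topspace X)"
    using x t by (auto simp: move_def admissible_def intro!: slide_topspace C_topspaceD[OF x])
  moreover have "slide (x i) (t i) \<in> V"
    if ij: "i \<in> I" "j \<in> I" "i \<noteq> j" and eq: "slide (x i) (t i) = slide (x j) (t j)" for i j
  proof -
    have ti: "t i \<in> {0..1}" "t j \<in> {0..1}" "x i \<in> A \<Longrightarrow> t i = 0" "x j \<in> A \<Longrightarrow> t j = 0"
      using t ij coord_0_iff[OF C_topspaceD[OF x]] by (auto simp: admissible_def)
    then have tt: "t i = t j"
      using coord_slide eq by metis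
    then have t01: "t i = 0 \<or> t i = 1"
      using t ij unfolding admissible_def by blast
    show ?thesis
    proof (cases "x i \<in> A")
      case False
      then show ?thesis using t01 \<psi>_in_V_iff[OF ti(1)] by (simp add: slide_def)
    next
      case i: True
      show ?thesis
      proof (cases "x j \<in> A")
        case True
        then show ?thesis using i eq x ij by (auto simp: slide_def topspace_conf)
      next
        case False
        then show ?thesis using t01 \<psi>_in_V_iff[OF ti(2)] unfolding eq by (auto simp: slide_def tt)
      qed
    qed
  qed
  ultimately show ?thesis
    by (auto simp: topspace_conf move_def)
qed

lemma coord_move:
  assumes "x \<in> topspace (C I)" "admissible I x t" "i \<in> I"
  shows "coord (move I x t i) = t i"
  using assms coord_0_iff[OF C_topspaceD]
  by (auto simp: move_def admissible_def intro!: coord_slide)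

lemma move_coord: "x \<in> topspace (C I) \<Longrightarrow> (\<And>i. i \<in> I \<Longrightarrow> t i = coord (x i)) \<Longrightarrow> move I x t = x"
  using slide_coord by (auto simp: move_def fun_eq_iff topspace_conf PiE_def extensional_def restrict_def Pi_def)

lemma continuous_C_coord [continuous_intros]:
  "i \<in> I \<Longrightarrow> continuous_map (subtopology (C I) W) euclideanreal (\<lambda>x. coord (x i))"
  using continuous_map_compose[OF continuous_map_conf_coordinate continuous_coord]
  by (auto simp: o_def intro!: continuous_map_from_subtopology)

lemma continuous_C_coord' [continuous_intros]:
  "i \<in> I \<Longrightarrow> continuous_map (C I) euclideanreal (\<lambda>x. coord (x i))"
  using continuous_C_coord[of i I UNIV] by simp

lemma continuous_C_coord_snd [continuous_intros]:
  assumes "i \<in> I"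
  shows "continuous_map (prod_topology T (subtopology (C I) W)) euclideanreal (\<lambda>z. coord (snd z i))"
  using continuous_map_compose[OF continuous_map_snd continuous_C_coord[OF assms]]
  by (simp add: o_def)

lemma continuous_I_fst [continuous_intros]:
  "continuous_map (prod_topology (top_of_set S) T) euclideanreal fst"
  by (metis continuous_map_fst continuous_map_into_fulltopology)

lemma homotopic_moves:
  fixes \<tau> :: "real \<Rightarrow> (nat \<Rightarrow> 'a) \<Rightarrow> nat \<Rightarrow> real"
  assumes W: "W \<subseteq> topspace (C I)"
    and cont: "\<And>i. i \<in> I \<Longrightarrow> continuous_map (prod_topology (top_of_set {0..1}) (subtopology (C I) W))
                   euclideanreal (\<lambda>z. \<tau> (fst z) (snd z) i)"
    and adm: "\<And>s x. 0 \<le> s \<Longrightarrow> s \<le> 1 \<Longrightarrow> x \<in> W \<Longrightarrow> admissible I x (\<tau> s x)"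
    and W': "\<And>s x. 0 \<le> s \<Longrightarrow> s \<le> 1 \<Longrightarrow> x \<in> W \<Longrightarrow> move I x (\<tau> s x) \<in> W'"
  shows "homotopic_with (\<lambda>_. True) (subtopology (C I) W) (subtopology (C I) W')
           (\<lambda>x. move I x (\<tau> 0 x)) (\<lambda>x. move I x (\<tau> 1 x))"
proof -
  let ?D = "prod_topology (top_of_set {0..1::real}) (subtopology (C I) W)"
  let ?h = "\<lambda>z. move I (snd z) (\<tau> (fst z) (snd z))"
  have D: "0 \<le> fst z" "fst z \<le> 1" "snd z \<in> W" if "z \<in> topspace ?D" for z
    using that by auto
  have "continuous_map ?D (C I) ?h"
  proof (rule continuous_map_into_conf)
    fix i assume i: "i \<in> I"
    have x: "continuous_map ?D X (\<lambda>z. snd z i)"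
      using continuous_map_compose[OF continuous_map_snd continuous_map_from_subtopology[OF continuous_map_conf_coordinate[OF i]]]
      by (simp add: o_def)
    have "continuous_map ?D X (\<lambda>z. slide (snd z i) (\<tau> (fst z) (snd z) i))"
    proof (rule continuous_slide[OF x cont[OF i]])
      fix z assume z: "z \<in> topspace ?D"
      then show "\<tau> (fst z) (snd z) i \<in> {0..1}" "snd z i \<in> A \<Longrightarrow> \<tau> (fst z) (snd z) i = 0"
        using adm[OF D[OF z]] i by (auto simp: admissible_def coord_def)
    qed
    then show "continuous_map ?D X (\<lambda>z. ?h z i)"
      using i by (simp add: move_def)
  next
    fix z assume z: "z \<in> topspace ?D"
    then show "?h z \<in> topspace (C I)"
      using W adm[OF D[OF z]] D[OF z] by (intro move_topspace) auto
  qed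
  then have "continuous_map ?D (subtopology (C I) W') ?h"
    using W' D by (auto simp: continuous_map_in_subtopology)
  then show ?thesis
    unfolding homotopic_with_def by (intro exI[of _ ?h]) auto
qed

end

section \<open>Contracting the complement of the wall\<close>

context pendant_edge
begin

lemma admissible_0: "x \<in> topspace (C I) \<Longrightarrow> admissible I x (\<lambda>_. 0)"
  by (auto simp: admissible_def)

definition base :: "nat set \<Rightarrow> (nat \<Rightarrow> 'a) set" where
  "base I = {x \<in> topspace (C I). \<forall>i\<in>I. x i \<in> A}"

lemma move_0_base: "x \<in> topspace (C I) \<Longrightarrow> move I x (\<lambda>_. 0) \<in> base I"
  using move_topspace[OF _ admissible_0] A_iff[of 0]
  by (auto simp: base_def move_def slide_def)

lemma move_0_id: "x \<in> base I \<Longrightarrow> move I x (\<lambda>_. 0) = x"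
  by (rule move_coord) (auto simp: base_def coord_def)

lemma move_move_0: "move I (move I x t) (\<lambda>_. 0) = move I x (\<lambda>_. 0)"
  if "x \<in> topspace (C I)" "admissible I x t"
  using that A_iff
  by (auto simp: move_def fun_eq_iff restrict_def slide_def admissible_def)

lemma continuous_move_0: "continuous_map (subtopology (C I) W) (subtopology (C I) (base I)) (\<lambda>x. move I x (\<lambda>_. 0))"
proof -
  have "homotopic_with (\<lambda>_. True) (subtopology (C I) (topspace (C I))) (subtopology (C I) (base I))
           (\<lambda>x. move I x (\<lambda>_. 0)) (\<lambda>x. move I x (\<lambda>_. 0))"
    using homotopic_moves[of "topspace (C I)" I "\<lambda>_ _ _. 0" "base I"] admissible_0 move_0_base
    by simp
  then show ?thesis
    by (auto intro: continuous_map_from_subtopology dest: homotopic_with_imp_continuous_maps)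
qed

lemma base_retract: "base I retract_of_space C I"
  unfolding retract_of_space_def
  using continuous_move_0[of I UNIV] move_0_id by (auto simp: base_def)

text \<open>
  The spanning tree of the cube graph: a label may be under way in the interior of the edge only if
  all smaller labels are still in \<open>A\<close>.
\<close>
definition staircase :: "nat set \<Rightarrow> (nat \<Rightarrow> 'a) set" where
  "staircase I = {x \<in> topspace (C I). \<forall>i\<in>I. \<forall>j\<in>I. j < i \<longrightarrow>
     coord (x i) = 0 \<or> coord (x i) = 1 \<or> coord (x j) = 0}"

text \<open>
  The midpoints of the cylinders outside the spanning tree. The condition \<open>1/2 \<le> coord (x j)\<close>, closed
  so that the wall is closed, amounts to a strict inequality as two labels cannot meet at \<open>1/2\<close>.
\<close>
definition wall :: "nat set \<Rightarrow> (nat \<Rightarrow> 'a) set" where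
  "wall I = {x \<in> topspace (C I). \<exists>i\<in>I. \<exists>j\<in>I. j < i \<and> coord (x i) = 1/2 \<and> 1/2 \<le> coord (x j)}"

definition clamp :: "real \<Rightarrow> real" where "clamp t = max 0 (min 1 t)"

text \<open>
  The labels return to \<open>A\<close> one after the other in increasing order: label \<open>i\<close> travels while \<open>s * N\<close> runs
  from \<open>i\<close> to \<open>i + 1\<close>. When its turn comes, all smaller labels are back, so the configuration stays
  in the staircase; a label that was in the interior of the edge from the beginning is the only one there.
\<close>
lemma staircase_contracts:
  assumes "finite I"
  shows "homotopic_with (\<lambda>_. True) (subtopology (C I) (staircase I)) (subtopology (C I) (staircase I))
      id (\<lambda>x. move I x (\<lambda>_. 0))"
proof -
  obtain N :: nat where N: "\<And>i. i \<in> I \<Longrightarrow> i < N"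
    using assms finite_nat_set_iff_bounded by auto
  define \<tau> where "\<tau> s x i = min (coord (x i)) (clamp (1 - (s * N - i)))" for s :: real and x :: "nat \<Rightarrow> 'a" and i :: nat
  have W: "staircase I \<subseteq> topspace (C I)"
    by (auto simp: staircase_def)
  have stair: "\<tau> s x i = 0 \<or> \<tau> s x i = 1 \<or> \<tau> s x j = 0"
    if s: "0 \<le> s" "s \<le> 1" and x: "x \<in> staircase I" and ij: "i \<in> I" "j \<in> I" "j < i" for s x i j
  proof -
    have b: "0 \<le> coord (x i)" "coord (x i) \<le> 1" "0 \<le> coord (x j)" "coord (x j) \<le> 1"
      using C_coord_bounds ij x W by blast+
    have "real j + 1 \<le> real i"
      using ij by linarith
    moreover have "coord (x i) = 0 \<or> coord (x i) = 1 \<or> coord (x j) = 0"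
      using x ij by (auto simp: staircase_def)
    ultimately show ?thesis
      using b by (auto simp: \<tau>_def clamp_def min_def max_def)
  qed
  have adm: "admissible I x (\<tau> s x)" if s: "0 \<le> s" "s \<le> 1" and x: "x \<in> staircase I" for s x
  proof -
    have "0 \<le> \<tau> s x i \<and> \<tau> s x i \<le> 1 \<and> (coord (x i) = 0 \<longrightarrow> \<tau> s x i = 0)" if "i \<in> I" for i
      using C_coord_bounds[of x I i] that x W by (auto simp: \<tau>_def clamp_def)
    moreover have "\<tau> s x i = 0 \<or> \<tau> s x i = 1" if ij: "i \<in> I" "j \<in> I" "i \<noteq> j" "\<tau> s x i = \<tau> s x j" for i j
      using stair[OF s x, of i j] stair[OF s x, of j i] ij by (cases "i < j") auto
    ultimately show ?thesis
      unfolding admissible_def by blast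
  qed
  have "homotopic_with (\<lambda>_. True) (subtopology (C I) (staircase I)) (subtopology (C I) (staircase I))
      (\<lambda>x. move I x (\<tau> 0 x)) (\<lambda>x. move I x (\<tau> 1 x))"
  proof (rule homotopic_moves[OF W])
    fix i assume "i \<in> I"
    then show "continuous_map (prod_topology (top_of_set {0..1}) (subtopology (C I) (staircase I)))
          euclideanreal (\<lambda>z. \<tau> (fst z) (snd z) i)"
      unfolding \<tau>_def clamp_def by (intro continuous_intros) auto
  next
    fix s x assume s: "0 \<le> s" "s \<le> (1::real)" and x: "x \<in> staircase I"
    then show "admissible I x (\<tau> s x)" by (rule adm)
    show "move I x (\<tau> s x) \<in> staircase I"
      using move_topspace[OF subsetD[OF W x] adm[OF s x]] coord_move[OF subsetD[OF W x] adm[OF s x]] stair[OF s x]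
      by (simp add: staircase_def)
  qed
  then show ?thesis
  proof (rule homotopic_with_eq)
    fix x assume "x \<in> topspace (subtopology (C I) (staircase I))"
    then have x: "x \<in> staircase I" "x \<in> topspace (C I)" by auto
    show "id x = move I x (\<tau> 0 x)"
    proof -
      have "\<tau> 0 x i = coord (x i)" if "i \<in> I" for i
        using C_coord_bounds[OF x(2) that] by (auto simp: \<tau>_def clamp_def)
      then show ?thesis
        using move_coord[OF x(2)] by simp
    qed
    have "\<tau> 1 x i = 0" if "i \<in> I" for i
    proof -
      have "real i + 1 \<le> N" using N[OF that] by linarith
      then show ?thesis
        using C_coord_bounds[OF x(2) that] by (auto simp: \<tau>_def clamp_def)
    qed
    then show "move I x (\<lambda>_. 0) = move I x (\<tau> 1 x)"
      by (auto simp: move_def)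
  qed auto
qed

text \<open>
  How far a configuration is from the wall. The factors, one for each pair of labels, lie in \<open>[0,1]\<close>
  and vanish only on the wall. The product replaces their minimum: it is a lower bound for every
  factor as well, and clearly continuous.
\<close>
definition gap :: "nat set \<Rightarrow> (nat \<Rightarrow> 'a) \<Rightarrow> real" where
  "gap I x = (1/2) * (\<Prod>(i, j) \<in> {(i, j). i \<in> I \<and> j \<in> I \<and> j < i}. max \<bar>coord (x i) - 1/2\<bar> (1/2 - coord (x j)))"

lemma finite_pairs: "finite I \<Longrightarrow> finite {(i, j). i \<in> I \<and> j \<in> I \<and> j < (i::nat)}"
  by (rule finite_subset[of _ "I \<times> I"]) auto

lemma gap_bounds:
  assumes "finite I" "x \<in> topspace (C I) - wall I"
  shows "0 < gap I x" "gap I x \<le> 1/2"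
    "\<And>i j. i \<in> I \<Longrightarrow> j \<in> I \<Longrightarrow> j < i \<Longrightarrow> gap I x \<le> \<bar>coord (x i) - 1/2\<bar> \<or> gap I x \<le> 1/2 - coord (x j)"
proof -
  let ?P = "{(i, j). i \<in> I \<and> j \<in> I \<and> j < i}"
  let ?q = "\<lambda>(i, j). max \<bar>coord (x i) - 1/2\<bar> (1/2 - coord (x j))"
  have q: "0 < ?q a \<and> ?q a \<le> 1" if "a \<in> ?P" for a
  proof -
    obtain i j where a: "a = (i, j)" "i \<in> I" "j \<in> I" "j < i" using \<open>a \<in> ?P\<close> by auto
    then have "0 \<le> coord (x i)" "coord (x i) \<le> 1" "0 \<le> coord (x j)" "coord (x j) \<le> 1"
      using C_coord_bounds assms(2) by blast+
    moreover have "\<not> (coord (x i) = 1/2 \<and> 1/2 \<le> coord (x j))"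
      using assms(2) a by (auto simp: wall_def)
    ultimately show ?thesis
      using a(1) by (auto simp: max_def abs_if)
  qed
  have fin: "finite ?P" by (rule finite_pairs[OF assms(1)])
  show "0 < gap I x"
    unfolding gap_def using q by (auto intro!: prod_pos)
  have "prod ?q ?P \<le> 1"
    using q by (intro prod_le_1) (auto simp: less_imp_le)
  then show "gap I x \<le> 1/2"
    by (simp add: gap_def)
  fix i j assume ij: "i \<in> I" "j \<in> I" "j < i"
  then have m: "(i, j) \<in> ?P" by auto
  have "prod ?q ?P = ?q (i, j) * prod ?q (?P - {(i, j)})"
    using fin m by (rule prod.remove)
  moreover have "0 \<le> prod ?q (?P - {(i, j)}) \<and> prod ?q (?P - {(i, j)}) \<le> 1"
    using q by (intro conjI prod_nonneg prod_le_1) (auto simp: less_imp_le)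
  ultimately have "prod ?q ?P \<le> ?q (i, j)"
    using q[OF m] mult_left_le[of "prod ?q (?P - {(i, j)})" "?q (i, j)"] by linarith
  moreover have "0 \<le> prod ?q ?P"
    using q by (intro prod_nonneg) (auto simp: less_imp_le)
  ultimately have "gap I x \<le> ?q (i, j)"
    unfolding gap_def by linarith
  then show "gap I x \<le> \<bar>coord (x i) - 1/2\<bar> \<or> gap I x \<le> 1/2 - coord (x j)"
    by (auto simp: max_def split: if_splits)
qed

text \<open>
  The edge is dilated about its midpoint by the factor \<open>l\<close> and what leaves \<open>[0,1]\<close> is pushed to
  the nearer end.
\<close>
definition stretch :: "real \<Rightarrow> real \<Rightarrow> real" where
  "stretch l t = clamp (1/2 + l * (t - 1/2))"

lemma stretch_bounds: "0 \<le> stretch l t" "stretch l t \<le> 1"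
  by (auto simp: stretch_def clamp_def)

lemma stretch_id: "0 \<le> t \<Longrightarrow> t \<le> 1 \<Longrightarrow> stretch 1 t = t"
  by (auto simp: stretch_def clamp_def)

lemma stretch_inj: "l > 0 \<Longrightarrow> stretch l t = stretch l t' \<Longrightarrow> stretch l t \<noteq> 0 \<Longrightarrow> stretch l t \<noteq> 1 \<Longrightarrow> t = t'"
  by (auto simp: stretch_def clamp_def max_def min_def split: if_splits)

lemma stretch_0: "l \<ge> 1 \<Longrightarrow> stretch l 0 = 0"
  by (auto simp: stretch_def clamp_def)

lemma stretch_1: "l \<ge> 1 \<Longrightarrow> stretch l 1 = 1"
  by (auto simp: stretch_def clamp_def)

lemma stretch_half_iff:
  assumes "l > 0" shows "stretch l t = 1/2 \<longleftrightarrow> t = 1/2"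
proof -
  have "clamp (1/2 + m) = 1/2 \<longleftrightarrow> m = 0" for m
    by (auto simp: clamp_def max_def min_def)
  then show ?thesis using assms by (auto simp: stretch_def)
qed

lemma stretch_ge_half_iff:
  assumes "l > 0" shows "1/2 \<le> stretch l t \<longleftrightarrow> 1/2 \<le> t"
proof -
  have "1/2 \<le> clamp (1/2 + m) \<longleftrightarrow> 0 \<le> m" for m
    by (auto simp: clamp_def max_def min_def)
  then show ?thesis using assms by (simp add: stretch_def zero_le_mult_iff)
qed

text \<open>
  The factor \<open>1 / (2 * c)\<close> is the one that sends the points at distance \<open>c\<close> from the midpoint to the
  ends.
\<close>
lemma stretch_extreme:
  assumes "0 < c" "c \<le> \<bar>t - 1/2\<bar>"
  shows "stretch (1 / (2 * c)) t = (if t < 1/2 then 0 else 1)"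
proof (cases "t < 1/2")
  case True
  then have "1 / (2 * c) * (t - 1/2) \<le> - 1/2"
    using assms by (auto simp: divide_simps)
  then have "1/2 + 1 / (2 * c) * (t - 1/2) \<le> 0" by linarith
  then have "clamp (1/2 + 1 / (2 * c) * (t - 1/2)) = 0" unfolding clamp_def by linarith
  then show ?thesis using True by (simp add: stretch_def)
next
  case False
  then have "1 / (2 * c) * (t - 1/2) \<ge> 1/2"
    using assms by (auto simp: divide_simps)
  then have "1/2 + 1 / (2 * c) * (t - 1/2) \<ge> 1" by linarith
  then have "clamp (1/2 + 1 / (2 * c) * (t - 1/2)) = 1" unfolding clamp_def by linarith
  then show ?thesis using False by (simp add: stretch_def)
qed

lemma continuous_gap [continuous_intros]:
  assumes "finite I"
  shows "continuous_map (prod_topology T (subtopology (C I) W)) euclideanreal (\<lambda>z. gap I (snd z))"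
proof -
  have "finite {p. fst p \<in> I \<and> snd p \<in> I \<and> snd p < fst p}"
    by (rule finite_subset[OF _ finite_cartesian_product[OF assms assms]]) auto
  then show ?thesis
    unfolding gap_def case_prod_unfold by (intro continuous_intros) auto
qed

text \<open>
  Off the wall, stretching by the reciprocal of twice the gap moves every configuration into the
  staircase: for labels \<open>j < i\<close>, either \<open>i\<close> is so far from the midpoint that it is sent to an end, or \<open>j\<close>
  is so far on the inner side that it is sent to \<open>\<psi> 0\<close>. Stretching fixes the midpoint and preserves the
  two halves of the edge, so it does not meet the wall on the way. The staircase then contracts.
\<close>
lemma wall_complement_contracts:
  assumes fin: "finite I"
  defines "U \<equiv> topspace (C I) - wall I"
  shows "homotopic_with (\<lambda>_. True) (subtopology (C I) U) (subtopology (C I) U) (\<lambda>x. move I x (\<lambda>_. 0)) id"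
proof -
  \<comment> \<open>The stretching factor grows linearly from 1 to the final value.\<close>
  define l where "l s x = (1 - s) * 1 + s * (1 / (2 * gap I x))" for s :: real and x :: "nat \<Rightarrow> 'a"
  define \<tau> where "\<tau> s x i = stretch (l s x) (coord (x i))" for s :: real and x :: "nat \<Rightarrow> 'a" and i :: nat
  have W: "U \<subseteq> topspace (C I)" by (auto simp: U_def)
  have SU: "staircase I \<subseteq> U"
  proof
    fix x assume x: "x \<in> staircase I"
    have "x \<notin> wall I"
    proof
      assume "x \<in> wall I"
      then obtain i j where "i \<in> I" "j \<in> I" "j < i" "coord (x i) = 1/2" "1/2 \<le> coord (x j)"
        by (auto simp: wall_def)
      moreover have "coord (x i) = 0 \<or> coord (x i) = 1 \<or> coord (x j) = 0"
        using calculation x by (auto simp: staircase_def)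
      ultimately show False by auto
    qed
    then show "x \<in> U" using x by (auto simp: U_def staircase_def)
  qed
  have l1: "1 \<le> l s x" if "0 \<le> s" "s \<le> 1" "x \<in> U" for s x
  proof -
    have "0 < gap I x" "gap I x \<le> 1/2"
      using gap_bounds[OF fin] that unfolding U_def by blast+
    then have "1 \<le> 1 / (2 * gap I x)" by (simp add: divide_simps)
    then have "s * 1 \<le> s * (1 / (2 * gap I x))" using that by (intro mult_left_mono)
    then show ?thesis by (simp add: l_def)
  qed
  have adm: "admissible I x (\<tau> s x)" if s: "0 \<le> s" "s \<le> 1" and x: "x \<in> U" for s x
  proof -
    have "\<tau> s x i = 0 \<or> \<tau> s x i = 1" if ij: "i \<in> I" "j \<in> I" "i \<noteq> j" "\<tau> s x i = \<tau> s x j" for i j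
    proof (rule ccontr)
      assume n: "\<not> ?thesis"
      then have "coord (x i) = coord (x j)"
        using ij(4) stretch_inj[of "l s x" "coord (x i)" "coord (x j)"] l1[OF s x] unfolding \<tau>_def by auto
      then have "coord (x i) = 0 \<or> coord (x i) = 1"
        using C_coord_collision ij x W by blast
      then show False
        using n stretch_0 stretch_1 l1[OF s x] by (auto simp: \<tau>_def)
    qed
    then show ?thesis
      unfolding admissible_def using stretch_bounds stretch_0 l1[OF s x] by (auto simp: \<tau>_def)
  qed
  have top: "move I x (\<tau> s x) \<in> topspace (C I)" and cm: "\<And>i. i \<in> I \<Longrightarrow> coord (move I x (\<tau> s x) i) = \<tau> s x i"
     if s: "0 \<le> s" "s \<le> 1" and x: "x \<in> U" for s x
    using move_topspace[OF subsetD[OF W x] adm[OF s x]] coord_move[OF subsetD[OF W x] adm[OF s x]] by auto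
  have inU: "move I x (\<tau> s x) \<in> U" if s: "0 \<le> s" "s \<le> 1" and x: "x \<in> U" for s x
  proof -
    have "l s x > 0" using l1[OF s x] by simp
    have "move I x (\<tau> s x) \<notin> wall I"
    proof
      assume "move I x (\<tau> s x) \<in> wall I"
      then obtain i j where ij: "i \<in> I" "j \<in> I" "j < i" "\<tau> s x i = 1/2" "1/2 \<le> \<tau> s x j"
        unfolding wall_def using cm[OF s x] by auto
      then have "coord (x i) = 1/2" "1/2 \<le> coord (x j)"
        using stretch_half_iff stretch_ge_half_iff \<open>l s x > 0\<close> unfolding \<tau>_def by blast+
      then show False
        using ij x by (auto simp: U_def wall_def)
    qed
    then show ?thesis
      using top[OF s x] by (simp add: U_def)
  qed
  have h1: "homotopic_with (\<lambda>_. True) (subtopology (C I) U) (subtopology (C I) U)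
      (\<lambda>x. move I x (\<tau> 0 x)) (\<lambda>x. move I x (\<tau> 1 x))"
  proof (rule homotopic_moves[OF W])
    fix i assume i: "i \<in> I"
    have "gap I (snd z) \<noteq> 0" if "z \<in> topspace (prod_topology (top_of_set {0..1::real}) (subtopology (C I) U))" for z
      using that gap_bounds(1)[OF fin, of "snd z"] by (auto simp: U_def)
    then show "continuous_map (prod_topology (top_of_set {0..1}) (subtopology (C I) U))
          euclideanreal (\<lambda>z. \<tau> (fst z) (snd z) i)"
      unfolding \<tau>_def l_def stretch_def clamp_def using i fin by (intro continuous_intros) auto
  qed (use adm inU in auto)
  have st: "move I x (\<tau> 1 x) \<in> staircase I" if x: "x \<in> U" for x
  proof -
    have "\<tau> 1 x i = 0 \<or> \<tau> 1 x i = 1 \<or> \<tau> 1 x j = 0" if ij: "i \<in> I" "j \<in> I" "j < i" for i j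
    proof -
      have g: "0 < gap I x" using gap_bounds(1)[OF fin] x unfolding U_def by blast
      have "gap I x \<le> \<bar>coord (x i) - 1/2\<bar> \<or> gap I x \<le> 1/2 - coord (x j)"
        using gap_bounds(3)[OF fin _ ij] x unfolding U_def by blast
      then show ?thesis
        using stretch_extreme[OF g, of "coord (x i)"] stretch_extreme[OF g, of "coord (x j)"] g
        by (auto simp: \<tau>_def l_def split: if_splits)
    qed
    then show ?thesis
      using top[OF _ _ x, of 1] cm[OF _ _ x, of 1] by (auto simp: staircase_def)
  qed
  have m1: "continuous_map (subtopology (C I) U) (subtopology (C I) (staircase I)) (\<lambda>x. move I x (\<tau> 1 x))"
    using homotopic_with_imp_continuous_maps[OF h1] st
    by (auto simp: continuous_map_in_subtopology)
  have "continuous_map (subtopology (C I) (staircase I)) (subtopology (C I) U) id"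
    using SU by (auto simp: continuous_map_in_subtopology intro!: continuous_map_from_subtopology)
  from homotopic_with_compose_continuous_map_left[OF staircase_contracts[OF fin] this, where q="\<lambda>_. True"]
  have "homotopic_with (\<lambda>_. True) (subtopology (C I) (staircase I)) (subtopology (C I) U) id (\<lambda>x. move I x (\<lambda>_. 0))"
    by (simp add: o_def id_def)
  from homotopic_with_compose_continuous_map_right[OF this m1, where q="\<lambda>_. True"]
  have h2: "homotopic_with (\<lambda>_. True) (subtopology (C I) U) (subtopology (C I) U)
     (\<lambda>x. move I x (\<tau> 1 x)) (\<lambda>x. move I (move I x (\<tau> 1 x)) (\<lambda>_. 0))"
    by (simp add: o_def)
  have "homotopic_with (\<lambda>_. True) (subtopology (C I) U) (subtopology (C I) U)
     (\<lambda>x. move I x (\<tau> 0 x)) (\<lambda>x. move I (move I x (\<tau> 1 x)) (\<lambda>_. 0))"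
    using homotopic_with_trans[OF h1 h2] .
  then have "homotopic_with (\<lambda>_. True) (subtopology (C I) U) (subtopology (C I) U) id (\<lambda>x. move I x (\<lambda>_. 0))"
  proof (rule homotopic_with_eq)
    fix x assume "x \<in> topspace (subtopology (C I) U)"
    then have x: "x \<in> U" "x \<in> topspace (C I)" by auto
    show "id x = move I x (\<tau> 0 x)"
      using C_coord_bounds[OF x(2)] move_coord[OF x(2), of "\<tau> 0 x"] by (simp add: \<tau>_def l_def stretch_id)
    show "move I x (\<lambda>_. 0) = move I (move I x (\<tau> 1 x)) (\<lambda>_. 0)"
      using move_move_0[OF x(2) adm[OF _ _ x(1), of 1]] by simp
  qed auto
  then show ?thesis
    by (simp add: homotopic_with_sym)
qed

lemma closedin_wall:
  assumes "finite I" shows "closedin (C I) (wall I)"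
proof -
  let ?P = "{(i, j). i \<in> I \<and> j \<in> I \<and> j < i}"
  have "wall I = (\<Union>(i, j) \<in> ?P. {x \<in> topspace (C I). coord (x i) \<le> 1/2} \<inter> {x \<in> topspace (C I). 1/2 \<le> coord (x i)}
        \<inter> {x \<in> topspace (C I). 1/2 \<le> coord (x j)})"
    by (auto simp: wall_def) force
  moreover have "closedin (C I) \<dots>"
    using finite_pairs[OF assms]
    by (intro closedin_Union finite_imageI) (auto intro!: closedin_Int closedin_Collect_le continuous_intros)
  ultimately show ?thesis by simp
qed

end

section \<open>The slabs around the wall\<close>

text \<open>
  A handle \<open>(i, T)\<close> is an edge of the cube outside the spanning tree: label \<open>i\<close> moves between \<open>\<psi> 0\<close> and
  \<open>\<psi> 1\<close> while exactly the labels of \<open>T\<close>, one of them smaller than \<open>i\<close>, wait at the leaf.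
\<close>
definition handles :: "nat set \<Rightarrow> (nat \<times> nat set) set" where
  "handles I = {(i, T). i \<in> I \<and> T \<subseteq> I - {i} \<and> (\<exists>j\<in>T. j < i)}"

lemma finite_handles: "finite I \<Longrightarrow> finite (handles I)"
  by (rule finite_subset[of _ "I \<times> Pow I"]) (auto simp: handles_def)

context pendant_edge
begin

text \<open>
  The neighbourhood of the component of the wall belonging to the handle \<open>(i, T)\<close>: label \<open>i\<close> is
  strictly closest to the midpoint, with coordinate in \<open>K\<close>, the labels of \<open>T\<close> are on the outer half of
  the edge and the others on the inner half or in \<open>A\<close>. The sets \<open>UNIV\<close>, \<open>{1/2<..}\<close>, \<open>{..<1/2}\<close> and \<open>{1/2}\<close>
  for \<open>K\<close> give the whole neighbourhood, its two sides and the wall component. Comparing distances to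
  the midpoint lets a linear motion to a normal form preserve these conditions.
\<close>
definition slab :: "nat set \<Rightarrow> real set \<Rightarrow> nat \<times> nat set \<Rightarrow> (nat \<Rightarrow> 'a) set" where
  "slab I K = (\<lambda>(i, T). {x \<in> topspace (C I). coord (x i) \<in> K \<and>
     (\<forall>k\<in>T. \<bar>coord (x i) - 1/2\<bar> < coord (x k) - 1/2) \<and>
     (\<forall>k\<in>I - T - {i}. \<bar>coord (x i) - 1/2\<bar> < 1/2 - coord (x k))})"

text \<open>
  The normal form of a configuration of the slab \<open>(i, T)\<close>, with label \<open>i\<close> at coordinate \<open>v\<close>.
\<close>
definition target :: "real \<Rightarrow> nat \<times> nat set \<Rightarrow> nat \<Rightarrow> real" where
  "target v = (\<lambda>(i, T) k. if k = i then v else if k \<in> T then 1 else 0)"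

lemma slab_topspace: "slab I K a \<subseteq> topspace (C I)"
  by (auto simp: slab_def split: prod.splits)

lemma openin_slab:
  assumes "finite I" "a \<in> handles I" "open K"
  shows "openin (C I) (slab I K a)"
proof -
  obtain i T where a: "a = (i, T)" by fastforce
  then have i: "i \<in> I" and T: "T \<subseteq> I" "finite T"
    using assms finite_subset[of T I] by (auto simp: handles_def)
  have "slab I K a = {x \<in> topspace (C I). coord (x i) \<in> K} \<inter>
      {x \<in> topspace (C I). \<forall>k\<in>T. \<bar>coord (x i) - 1/2\<bar> < coord (x k) - 1/2} \<inter>
      {x \<in> topspace (C I). \<forall>k\<in>I - T - {i}. \<bar>coord (x i) - 1/2\<bar> < 1/2 - coord (x k)}"
    by (auto simp: slab_def a)
  moreover have "openin (C I) {x \<in> topspace (C I). coord (x i) \<in> K}"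
    by (rule openin_continuous_map_preimage[OF continuous_C_coord'[OF i]]) (use assms in auto)
  moreover have "openin (C I) {x \<in> topspace (C I). \<forall>k\<in>T. \<bar>coord (x i) - 1/2\<bar> < coord (x k) - 1/2}"
    using T i by (intro openin_Collect_ball openin_Collect_less continuous_intros) auto
  moreover have "openin (C I) {x \<in> topspace (C I). \<forall>k\<in>I - T - {i}. \<bar>coord (x i) - 1/2\<bar> < 1/2 - coord (x k)}"
    using assms(1) i by (intro openin_Collect_ball openin_Collect_less continuous_intros) auto
  ultimately show ?thesis
    by auto
qed

text \<open>
  A handle has a label \<open>j\<close> in \<open>T\<close>, whose distance to the midpoint is at most \<open>1/2\<close>, and \<open>i\<close> is closer.
\<close>
lemma slab_coord_interior:
  assumes a: "(i, T) \<in> handles I" and x: "x \<in> slab I K (i, T)"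
  shows "0 < coord (x i)" "coord (x i) < 1"
proof -
  obtain j where "j \<in> T" "j \<in> I" using a by (auto simp: handles_def)
  then have "\<bar>coord (x i) - 1/2\<bar> < coord (x j) - 1/2" "coord (x j) \<le> 1"
    using x C_coord_bounds by (auto simp: slab_def)
  then show "0 < coord (x i)" "coord (x i) < 1" by auto
qed

text \<open>
  The label closest to the midpoint is unique, and it determines the labels on the outer half.
\<close>
lemma slab_disjoint:
  assumes "a \<in> handles I" "b \<in> handles I" "a \<noteq> b"
  shows "slab I K a \<inter> slab I L b = {}"
proof (rule ccontr)
  assume "\<not> ?thesis"
  then obtain x where x: "x \<in> slab I K a" "x \<in> slab I L b" by auto
  obtain i T where a: "a = (i, T)" by fastforce
  obtain j S where b: "b = (j, S)" by fastforce
  have sub: "i \<in> I" "T \<subseteq> I - {i}" "j \<in> I" "S \<subseteq> I - {j}"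
    using assms a b by (auto simp: handles_def)
  have 1: "\<bar>coord (x i) - 1/2\<bar> < coord (x k) - 1/2" if "k \<in> T" for k
    using that x by (auto simp: slab_def a)
  have 2: "\<bar>coord (x i) - 1/2\<bar> < 1/2 - coord (x k)" if "k \<in> I - T - {i}" for k
    using that x by (auto simp: slab_def a)
  have 3: "\<bar>coord (x j) - 1/2\<bar> < coord (x k) - 1/2" if "k \<in> S" for k
    using that x by (auto simp: slab_def b)
  have 4: "\<bar>coord (x j) - 1/2\<bar> < 1/2 - coord (x k)" if "k \<in> I - S - {j}" for k
    using that x by (auto simp: slab_def b)
  have ij: "i = j"
  proof (rule ccontr)
    assume "i \<noteq> j"
    then have "\<bar>coord (x i) - 1/2\<bar> < \<bar>coord (x j) - 1/2\<bar>"
      using 1[of j] 2[of j] sub by (cases "j \<in> T") auto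
    moreover have "\<bar>coord (x j) - 1/2\<bar> < \<bar>coord (x i) - 1/2\<bar>"
      using 3[of i] 4[of i] sub \<open>i \<noteq> j\<close> by (cases "i \<in> S") auto
    ultimately show False by simp
  qed
  have "T = S"
  proof -
    have "k \<in> S" if "k \<in> T" for k
      using 1[OF that] 4[of k] that sub ij by fastforce
    moreover have "k \<in> T" if "k \<in> S" for k
      using 3[OF that] 2[of k] that sub ij by fastforce
    ultimately show ?thesis by auto
  qed
  then show False
    using ij a b assms(3) by simp
qed

text \<open>
  All coordinates move linearly to the normal form. Label \<open>i\<close> remains strictly closest to the midpoint,
  because \<open>v\<close> is closer to it than the ends are. Labels on the same half keep their order until they
  merge at an end, and the others are separated by the midpoint.
\<close>
lemma slab_contracts:
  assumes a: "a \<in> handles I" and K: "convex K" "v \<in> K" and v: "0 < v" "v < 1"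
  shows "homotopic_with (\<lambda>_. True) (subtopology (C I) (slab I K a)) (subtopology (C I) (slab I K a))
      (\<lambda>x. move I x (target v a)) id"
    and "\<And>x. x \<in> slab I UNIV a \<Longrightarrow> move I x (target v a) \<in> slab I K a"
proof -
  obtain i T where aT: "a = (i, T)" by fastforce
  have sub: "i \<in> I" "T \<subseteq> I - {i}"
    using a aT by (auto simp: handles_def)
  define \<tau> where "\<tau> s x k = (1 - s) * coord (x k) + s * target v a k" for s :: real and x :: "nat \<Rightarrow> 'a" and k :: nat
  have \<tau>1: "\<tau> 1 x = target v a" for x
    by (rule ext) (simp add: \<tau>_def)
  have main: "admissible I x (\<tau> s x) \<and> (L = K \<or> s = 1 \<longrightarrow> move I x (\<tau> s x) \<in> slab I K a)"
    if s: "0 \<le> s" "s \<le> 1" and x: "x \<in> slab I L a" for s x L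
  proof -
    have xt: "x \<in> topspace (C I)" using x slab_topspace by blast
    have bnd: "0 \<le> coord (x k)" "coord (x k) \<le> 1" if "k \<in> I" for k
      using C_coord_bounds[OF xt that] by auto
    have pi: "0 < coord (x i)" "coord (x i) < 1"
      using slab_coord_interior[OF a[unfolded aT] x[unfolded aT]] by auto
    have 1: "\<bar>coord (x i) - 1/2\<bar> < coord (x k) - 1/2" if "k \<in> T" for k
      using that x by (auto simp: slab_def aT)
    have 2: "\<bar>coord (x i) - 1/2\<bar> < 1/2 - coord (x k)" if "k \<in> I - T - {i}" for k
      using that x by (auto simp: slab_def aT)
    have dist: "\<bar>\<tau> s x i - 1/2\<bar> < (1 - s) * d + s * (1/2)" if "\<bar>coord (x i) - 1/2\<bar> < d" for d
    proof -
      have "\<tau> s x i - 1/2 = (1 - s) * (coord (x i) - 1/2) + s * (v - 1/2)"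
        by (simp add: \<tau>_def target_def aT field_simps)
      then have "\<bar>\<tau> s x i - 1/2\<bar> \<le> (1 - s) * \<bar>coord (x i) - 1/2\<bar> + s * \<bar>v - 1/2\<bar>"
        using s abs_triangle_ineq[of "(1 - s) * (coord (x i) - 1/2)" "s * (v - 1/2)"] by (simp add: abs_mult)
      also have "\<dots> < (1 - s) * d + s * (1/2)"
      proof (cases "s = 0")
        case True then show ?thesis using that by simp
      next
        case False
        have "\<bar>v - 1/2\<bar> < 1/2" using v by linarith
        then have "s * \<bar>v - 1/2\<bar> < s * (1/2)" using False s by (intro mult_strict_left_mono) auto
        moreover have "(1 - s) * \<bar>coord (x i) - 1/2\<bar> \<le> (1 - s) * d"
          using that s by (intro mult_left_mono) auto
        ultimately show ?thesis by simp
      qed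
      finally show ?thesis .
    qed
    have t1: "\<bar>\<tau> s x i - 1/2\<bar> < \<tau> s x k - 1/2" if "k \<in> T" for k
    proof -
      have "k \<noteq> i" using that sub by auto
      then have "\<tau> s x k - 1/2 = (1 - s) * (coord (x k) - 1/2) + s * (1/2)"
        using that by (simp add: \<tau>_def target_def aT field_simps)
      then show ?thesis using dist[OF 1[OF that]] by simp
    qed
    have t2: "\<bar>\<tau> s x i - 1/2\<bar> < 1/2 - \<tau> s x k" if "k \<in> I - T - {i}" for k
    proof -
      have "1/2 - \<tau> s x k = (1 - s) * (1/2 - coord (x k)) + s * (1/2)"
        using that by (simp add: \<tau>_def target_def aT field_simps)
      then show ?thesis using dist[OF 2[OF that]] by simp
    qed
    have tb: "0 \<le> \<tau> s x k \<and> \<tau> s x k \<le> 1 \<and> (coord (x k) = 0 \<longrightarrow> \<tau> s x k = 0)" if k: "k \<in> I" for k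
    proof -
      have t01: "0 \<le> target v a k" "target v a k \<le> 1"
        using v by (auto simp: target_def aT)
      have "0 \<le> \<tau> s x k"
        using s bnd[OF k] t01 by (simp add: \<tau>_def)
      moreover have "\<tau> s x k \<le> (1 - s) * 1 + s * 1"
        using s bnd[OF k] t01 unfolding \<tau>_def by (intro add_mono mult_left_mono) auto
      moreover have "target v a k = 0" if "coord (x k) = 0"
        using that pi 1[of k] by (auto simp: target_def aT)
      ultimately show ?thesis
        by (auto simp: \<tau>_def)
    qed
    have inj: "\<tau> s x k = 0 \<or> \<tau> s x k = 1" if k: "k \<in> I" "l \<in> I" "k \<noteq> l" "\<tau> s x k = \<tau> s x l" for k l
    proof -
      have ki: "k \<noteq> i" "l \<noteq> i"
        using t1[of l] t2[of l] t1[of k] t2[of k] k by fastforce+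
      have kT: "k \<in> T \<longleftrightarrow> l \<in> T"
        using t1[of l] t2[of l] t1[of k] t2[of k] k ki by fastforce
      show ?thesis
      proof (cases "s = 1")
        case True
        then show ?thesis using ki by (simp add: \<tau>_def target_def aT)
      next
        case False
        have eq: "target v a k = target v a l"
          using ki kT by (simp add: target_def aT)
        then have "coord (x k) = coord (x l)"
          using k(4) False by (simp add: \<tau>_def)
        then have c: "coord (x k) = 0 \<or> coord (x k) = 1"
          using C_coord_collision[OF xt] k by blast
        show ?thesis
        proof (cases "k \<in> T")
          case True
          then have "coord (x k) = 1" using c 1[OF True] by auto
          then show ?thesis using True ki by (simp add: \<tau>_def target_def aT)
        next
          case False
          then have "coord (x k) = 0" using c 2[of k] k ki by auto
          then show ?thesis using False ki by (simp add: \<tau>_def target_def aT)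
        qed
      qed
    qed
    have adm: "admissible I x (\<tau> s x)"
      unfolding admissible_def using tb inj by blast
    have cm: "coord (move I x (\<tau> s x) k) = \<tau> s x k" if "k \<in> I" for k
      using coord_move[OF xt adm that] .
    moreover have "\<tau> s x i \<in> K" if "L = K \<or> s = 1"
    proof -
      have "target v a i = v" by (simp add: target_def aT)
      moreover have "coord (x i) \<in> L" using x by (auto simp: slab_def aT)
      ultimately show ?thesis
        using that K s convexD[OF K(1), of "coord (x i)" v "1 - s" s] by (auto simp: \<tau>_def)
    qed
    moreover have "\<forall>k\<in>T. k \<in> I" "\<forall>k\<in>I - T - {i}. k \<in> I" using sub by auto
    ultimately have "L = K \<or> s = 1 \<longrightarrow> move I x (\<tau> s x) \<in> slab I K a"
      using move_topspace[OF xt adm] t1 t2 sub(1) by (simp add: slab_def aT)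
    with adm show ?thesis by blast
  qed
  have "homotopic_with (\<lambda>_. True) (subtopology (C I) (slab I K a)) (subtopology (C I) (slab I K a))
      (\<lambda>x. move I x (\<tau> 0 x)) (\<lambda>x. move I x (\<tau> 1 x))"
  proof (rule homotopic_moves[OF slab_topspace])
    fix k assume "k \<in> I"
    then show "continuous_map (prod_topology (top_of_set {0..1}) (subtopology (C I) (slab I K a)))
          euclideanreal (\<lambda>z. \<tau> (fst z) (snd z) k)"
      unfolding \<tau>_def by (intro continuous_intros) auto
  qed (use main in blast)+
  then have "homotopic_with (\<lambda>_. True) (subtopology (C I) (slab I K a)) (subtopology (C I) (slab I K a))
      id (\<lambda>x. move I x (target v a))"
  proof (rule homotopic_with_eq)
    fix x assume "x \<in> topspace (subtopology (C I) (slab I K a))"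
    then have "x \<in> topspace (C I)" by auto
    then show "id x = move I x (\<tau> 0 x)"
      using move_coord[of x I "\<tau> 0 x"] by (simp add: \<tau>_def)
    show "move I x (target v a) = move I x (\<tau> 1 x)"
      by (simp add: \<tau>1)
  qed auto
  then show "homotopic_with (\<lambda>_. True) (subtopology (C I) (slab I K a)) (subtopology (C I) (slab I K a))
      (\<lambda>x. move I x (target v a)) id"
    by (simp add: homotopic_with_sym)
  show "move I x (target v a) \<in> slab I K a" if "x \<in> slab I UNIV a" for x
    using main[OF _ _ that, of 1] by (simp add: \<tau>1)
qed

definition place :: "nat set \<Rightarrow> real \<Rightarrow> nat \<times> nat set \<Rightarrow> (nat \<Rightarrow> 'a) \<Rightarrow> nat \<Rightarrow> 'a" where
  "place I v = (\<lambda>(i, T) y. \<lambda>k\<in>I. if k = i then \<psi> v else if k \<in> T then \<psi> 1 else y k)"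

lemma place_slab:
  assumes a: "(i, T) \<in> handles I" and v: "0 < v" "v < 1" "v \<in> K"
    and y: "y \<in> topspace (conf (I - T - {i}) (subtopology X A) V)"
  shows "place I v (i, T) y \<in> slab I K (i, T)"
proof -
  let ?x = "place I v (i, T) y"
  have sub: "i \<in> I" "T \<subseteq> I - {i}"
    using a by (auto simp: handles_def)
  have yA: "y k \<in> A" "y k \<in> topspace X" if "k \<in> I - T - {i}" for k
    using y that by (auto simp: topspace_conf PiE_iff)
  have \<psi>v: "\<psi> v \<notin> A" "\<psi> 1 \<notin> A" "\<psi> 1 \<in> V" "\<psi> v \<in> topspace X" "\<psi> 1 \<in> topspace X"
    using A_iff[of v] A_iff[of 1] \<psi>_in_V_iff[of 1] \<psi>_topspace v by auto
  have ne: "\<psi> v \<noteq> \<psi> 1"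
    using \<psi>_in_V_iff[of v] v \<psi>v by auto
  have "?x \<in> (\<Pi>\<^sub>E i\<in>I. topspace X)"
    using \<psi>v yA by (auto simp: place_def)
  moreover have "?x k \<in> V" if "k \<in> I" "l \<in> I" "k \<noteq> l" "?x k = ?x l" for k l
  proof -
    have "y k \<in> V" if "k \<in> I - T - {i}" "l \<in> I - T - {i}" "y k = y l"
      using y that \<open>k \<noteq> l\<close> by (auto simp: topspace_conf)
    then show ?thesis
      using that \<psi>v ne yA[of k] yA[of l] by (auto simp: place_def split: if_splits)
  qed
  ultimately have "?x \<in> topspace (C I)"
    by (auto simp: topspace_conf)
  moreover have "coord (?x i) = v" "\<And>k. k \<in> T \<Longrightarrow> coord (?x k) = 1" "\<And>k. k \<in> I - T - {i} \<Longrightarrow> coord (?x k) = 0"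
    using sub v coord_\<psi>[of v] coord_\<psi>[of 1] yA by (auto simp: place_def coord_0_iff)
  moreover have "\<bar>v - 1/2\<bar> < 1/2" using v(1,2) by linarith
  ultimately show ?thesis
    using v by (auto simp: slab_def)
qed

text \<open>
  Forgetting the labels \<open>i\<close> and \<open>T\<close> and pushing the others into \<open>A\<close> is inverse, up to the contraction of
  the slab, to placing \<open>i\<close> at coordinate \<open>v\<close> and \<open>T\<close> at the leaf.
\<close>
lemma slab_homology:
  assumes a: "(i, T) \<in> handles I" and K: "convex K" "v \<in> K" and v: "0 < v" "v < 1"
  shows "homology_group q (subtopology (C I) (slab I K (i, T)))
       \<cong> homology_group q (conf (I - T - {i}) (subtopology X A) V)"
proof -
  let ?B = "I - T - {i}" and ?D = "subtopology (C I) (slab I K (i, T))"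
  let ?r = "\<lambda>x. restrict (move I x (\<lambda>_. 0)) ?B" and ?s = "place I v (i, T)"
  have sub: "i \<in> I" "T \<subseteq> I - {i}"
    using a by (auto simp: handles_def)
  have rtop: "?r x \<in> topspace (conf ?B (subtopology X A) V)" if "x \<in> topspace (C I)" for x
  proof -
    have "move I x (\<lambda>_. 0) \<in> base I" by (rule move_0_base[OF that])
    then show ?thesis by (auto simp: base_def topspace_conf PiE_iff)
  qed
  have r: "continuous_map ?D (conf ?B (subtopology X A) V) ?r"
  proof (rule continuous_map_into_conf)
    fix k assume k: "k \<in> ?B"
    have "continuous_map ?D (C I) (\<lambda>x. move I x (\<lambda>_. 0))"
      using continuous_move_0 continuous_map_into_fulltopology by blast
    from continuous_map_compose[OF this continuous_map_conf_coordinate[of k]] k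
    have "continuous_map ?D X (\<lambda>x. ?r x k)"
      by (simp add: o_def)
    moreover have "?r x k \<in> A" if "x \<in> topspace ?D" for x
    proof -
      have "?r x \<in> topspace (conf ?B (subtopology X A) V)"
        using rtop that by auto
      then show ?thesis using k by (auto simp only: topspace_conf PiE_iff topspace_subtopology)
    qed
    ultimately show "continuous_map ?D (subtopology X A) (\<lambda>x. ?r x k)"
      by (auto simp only: continuous_map_in_subtopology)
  qed (use rtop in auto)
  have s: "continuous_map (conf ?B (subtopology X A) V) ?D ?s"
  proof -
    have "continuous_map (conf ?B (subtopology X A) V) (C I) ?s"
    proof (rule continuous_map_into_conf)
      fix k assume k: "k \<in> I"
      consider "k = i" | "k \<in> T" "k \<noteq> i" | "k \<in> ?B" using k by auto
      then show "continuous_map (conf ?B (subtopology X A) V) X (\<lambda>y. ?s y k)"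
      proof cases
        case 3
        then show ?thesis
          using k continuous_map_into_fulltopology[OF continuous_map_conf_coordinate[OF 3]]
          by (simp add: place_def)
      qed (use k \<psi>_topspace[of v] \<psi>_topspace[of 1] v in \<open>auto simp: place_def\<close>)
    qed (use place_slab[OF a v K(2)] slab_topspace in blast)
    then show ?thesis
      using place_slab[OF a v K(2)] by (auto simp: continuous_map_in_subtopology)
  qed
  have sr: "homotopic_with (\<lambda>_. True) ?D ?D (?s \<circ> ?r) id"
  proof (rule homotopic_with_eq[OF slab_contracts(1)[OF a K v]])
    fix x assume "x \<in> topspace ?D"
    then have x: "x \<in> slab I K (i, T)" "x \<in> topspace (C I)" by auto
    have "x i \<notin> A"
      using slab_coord_interior[OF a x(1)] by (auto simp: coord_def)
    moreover have "x k \<notin> A" if "k \<in> T" for k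
      using that x(1) by (force simp: slab_def coord_def)
    ultimately show "(?s \<circ> ?r) x = move I x (target v (i, T))"
      by (auto simp: place_def target_def move_def fun_eq_iff restrict_def slide_def)
  qed auto
  have rs: "homotopic_with (\<lambda>_. True) (conf ?B (subtopology X A) V) (conf ?B (subtopology X A) V) (?r \<circ> ?s) id"
  proof (rule homotopic_with_id2)
    fix y assume y: "y \<in> topspace (conf ?B (subtopology X A) V)"
    then have "y k \<in> A" if "k \<in> ?B" for k
      using that by (auto simp: topspace_conf PiE_iff)
    moreover have "y k = undefined" if "k \<notin> ?B" for k
      using y that by (auto simp: topspace_conf PiE_def extensional_def)
    ultimately show "?r (?s y) = y"
      by (auto simp: place_def move_def fun_eq_iff restrict_def slide_def)
  qed
  show ?thesis
    using homotopy_equivalence_homology_group_isomorphism[OF r s sr rs] is_isoI by blast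
qed

end

section \<open>Homology after attaching a pendant edge\<close>

context pendant_edge
begin

text \<open>
  At the midpoint there is at most one label, so \<open>T\<close> has to consist of the labels further out.
\<close>
lemma wall_iff_slab:
  "wall I = (\<Union>a\<in>handles I. slab I {1/2} a)"
proof (intro subset_antisym subsetI)
  fix x assume x: "x \<in> wall I"
  then obtain i j where ij: "i \<in> I" "j \<in> I" "j < i" "coord (x i) = 1/2" "1/2 \<le> coord (x j)" and xt: "x \<in> topspace (C I)"
    by (auto simp: wall_def)
  have ne: "coord (x k) \<noteq> 1/2" if "k \<in> I" "k \<noteq> i" for k
    using C_coord_collision[OF xt ij(1) that(1)] that ij by auto
  define T where "T = {k \<in> I - {i}. 1/2 < coord (x k)}"
  have "(i, T) \<in> handles I"
    using ij ne[of j] by (auto simp: handles_def T_def)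
  moreover have "x \<in> slab I {1/2} (i, T)"
    using xt ij ne by (force simp: slab_def T_def)
  ultimately show "x \<in> (\<Union>a\<in>handles I. slab I {1/2} a)" by blast
next
  fix x assume "x \<in> (\<Union>a\<in>handles I. slab I {1/2} a)"
  then obtain i T where "(i, T) \<in> handles I" "x \<in> slab I {1/2} (i, T)" by fast
  then show "x \<in> wall I"
    unfolding handles_def slab_def wall_def by fastforce
qed

lemma slab_nonempty:
  assumes "a \<in> handles I" "0 < v" "v < 1" "v \<in> K"
  shows "slab I K a \<noteq> {}"
proof -
  obtain i T where a: "a = (i, T)" by fastforce
  have "\<psi> 0 \<in> A" "\<psi> 0 \<in> V" "\<psi> 0 \<in> topspace X"
    using A_iff[of 0] \<psi>_in_V_iff[of 0] \<psi>_topspace[of 0] by auto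
  then have "(\<lambda>k\<in>I - T - {i}. \<psi> 0) \<in> topspace (conf (I - T - {i}) (subtopology X A) V)"
    by (auto simp: topspace_conf)
  then show ?thesis
    using place_slab[of i T I v K] assms a by blast
qed

text \<open>
  The handle attachment applies with the slabs as neighbourhood of the wall. The outer side of a slab
  is the one into which the neighbourhood is contracted, by moving the label closest to the midpoint
  to coordinate \<open>3/4\<close>; the homology of the inner side remains.
\<close>
theorem homology_conf_pendant_edge:
  assumes fin: "finite I"
  defines "M \<equiv> \<Union>a\<in>handles I. slab I {..<1/2} a"
  shows "homology_group p (C I) \<cong>
    homology_group p (subtopology (C I) (base I)) \<times>\<times> homology_group (p - 1) (subtopology (C I) M)"
proof (rule homology_handle_attachment[where Z="wall I" and f="\<lambda>x. move I x (\<lambda>_. 0)"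
      and N="\<Union>a\<in>handles I. slab I UNIV a" and P="\<Union>a\<in>handles I. slab I {1/2<..} a"])
  let ?N = "\<Union>a\<in>handles I. slab I UNIV a" and ?P = "\<Union>a\<in>handles I. slab I {1/2<..} a"
  \<comment> \<open>The handle to which a configuration near the wall belongs.\<close>
  define idx where "idx x = (THE a. a \<in> handles I \<and> x \<in> slab I UNIV a)" for x
  have idx: "idx x = a" if "a \<in> handles I" "x \<in> slab I UNIV a" for x a
    unfolding idx_def using that slab_disjoint[of _ I a UNIV UNIV] by (intro the_equality) auto
  define g where "g x = move I x (target (3/4) (idx x))" for x
  have mono: "slab I K a \<subseteq> slab I L a" if "K \<subseteq> L" for K L a
    using that by (auto simp: slab_def split: prod.splits)
  have g_slab: "homotopic_with (\<lambda>_. True) (subtopology (C I) (slab I K a)) (subtopology (C I) (\<Union>a\<in>handles I. slab I K a)) g id"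
    if a: "a \<in> handles I" and K: "convex K" "3/4 \<in> K" for a K
  proof (rule homotopic_with_eq)
    have "continuous_map (subtopology (C I) (slab I K a)) (subtopology (C I) (\<Union>a\<in>handles I. slab I K a)) id"
      using a by (auto simp: continuous_map_in_subtopology intro: continuous_map_from_subtopology)
    from homotopic_with_compose_continuous_map_left[OF slab_contracts(1)[OF a K] this, where q="\<lambda>_. True"]
    show "homotopic_with (\<lambda>_. True) (subtopology (C I) (slab I K a)) (subtopology (C I) (\<Union>a\<in>handles I. slab I K a))
        (\<lambda>x. move I x (target (3/4) a)) id"
      by (simp add: o_def id_def)
    fix x assume "x \<in> topspace (subtopology (C I) (slab I K a))"
    then have "x \<in> slab I UNIV a" using mono[of K UNIV a] by auto
    then show "g x = move I x (target (3/4) a)"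
      using idx[OF a] by (simp add: g_def)
  qed auto
  have g: "homotopic_with (\<lambda>_. True) (subtopology (C I) (\<Union>a\<in>handles I. slab I K a))
      (subtopology (C I) (\<Union>a\<in>handles I. slab I K a)) g id"
    if K: "convex K" "3/4 \<in> K" "open K" for K
    using openin_slab[OF fin _ K(3)] slab_disjoint g_slab[OF _ K(1,2)]
    by (intro homotopic_with_disjoint_union) auto
  show "base I retract_of_space C I" by (rule base_retract)
  show "closedin (C I) (wall I)" by (rule closedin_wall[OF fin])
  show "base I \<inter> wall I = {}"
    by (auto simp: base_def wall_def coord_def)
  show "continuous_map (subtopology (C I) (topspace (C I) - wall I)) (subtopology (C I) (base I)) (\<lambda>x. move I x (\<lambda>_. 0))"
    by (rule continuous_move_0)
  show "move I x (\<lambda>_. 0) = x" if "x \<in> base I" for x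
    using that by (rule move_0_id)
  show "homotopic_with (\<lambda>h. True) (subtopology (C I) (topspace (C I) - wall I))
     (subtopology (C I) (topspace (C I) - wall I)) (\<lambda>x. move I x (\<lambda>_. 0)) id"
    by (rule wall_complement_contracts[OF fin])
  show "openin (C I) ?N" "openin (C I) ?P" "openin (C I) M"
    unfolding M_def using openin_slab[OF fin] by (auto intro!: openin_Union)
  show "wall I \<subseteq> ?N"
    unfolding wall_iff_slab using mono[of "{1/2}" UNIV] by blast
  show "?P \<inter> M = {}"
  proof (rule ccontr)
    assume "\<not> ?thesis"
    then obtain x a b where *: "a \<in> handles I" "b \<in> handles I" "x \<in> slab I {1/2<..} a" "x \<in> slab I {..<1/2} b"
      by (auto simp: M_def)
    then have "a = b" using slab_disjoint[of a I b] by blast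
    with * show False by (auto simp: slab_def split: prod.splits)
  qed
  show "?P \<union> M = ?N - wall I"
  proof -
    have "slab I UNIV a = slab I {1/2<..} a \<union> slab I {..<1/2} a \<union> slab I {1/2} a" for a
      by (auto simp: slab_def split: prod.splits)
    moreover have "(slab I {1/2<..} a \<union> slab I {..<1/2} a) \<inter> slab I {1/2} b = {}"
      if "a \<in> handles I" "b \<in> handles I" for a b
    proof (cases "a = b")
      case True then show ?thesis by (auto simp: slab_def split: prod.splits)
    next
      case False then show ?thesis using slab_disjoint[OF that] by blast
    qed
    ultimately show ?thesis
      unfolding wall_iff_slab M_def by blast
  qed
  show "continuous_map (subtopology (C I) ?N) (subtopology (C I) ?P) g"
  proof -
    have "continuous_map (subtopology (C I) ?N) (C I) g"
      using homotopic_with_imp_continuous_maps[OF g[of UNIV]] continuous_map_into_fulltopology by auto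
    moreover have "g x \<in> ?P" if "x \<in> ?N" for x
    proof -
      obtain a where a: "a \<in> handles I" "x \<in> slab I UNIV a" using \<open>x \<in> ?N\<close> by blast
      then have "g x \<in> slab I {1/2<..} a"
        unfolding g_def idx[OF a] by (intro slab_contracts(2)) auto
      then show ?thesis using a by blast
    qed
    ultimately show ?thesis by (auto simp: continuous_map_in_subtopology)
  qed
  show "homotopic_with (\<lambda>h. True) (subtopology (C I) ?P) (subtopology (C I) ?P) g id"
    by (rule g) auto
  show "homotopic_with (\<lambda>h. True) (subtopology (C I) ?N) (subtopology (C I) ?N) g id"
    by (rule g) auto
qed

text \<open>
  The inner sides of the slabs are disjoint and open, so their homology adds up.
\<close>
theorem free_of_rank_homology_conf:
  assumes fin: "finite I"
    and rank: "\<And>J q. J \<subseteq> I \<Longrightarrow> free_of_rank (homology_group q (conf J (subtopology X A) V)) (r J q)"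
  shows "free_of_rank (homology_group p (conf I X V)) (r I p + (\<Sum>(i, T)\<in>handles I. r (I - T - {i}) (p - 1)))"
proof -
  let ?c = "slab I {..<1/2}" and ?M = "\<Union>a\<in>handles I. slab I {..<1/2} a"
  let ?r = "\<lambda>(i, T). r (I - T - {i}) (p - 1)"
  have ne: "?c a \<noteq> {}" if "a \<in> handles I" for a
    using that by (rule slab_nonempty[of _ _ "1/4"]) auto
  have disj: "?c a \<inter> ?c b = {}" if "a \<in> handles I" "b \<in> handles I" "a \<noteq> b" for a b
    using that by (rule slab_disjoint)
  have inj: "inj_on ?c (handles I)"
    using ne disj by (intro inj_onI) blast
  have rc: "free_of_rank (homology_group (p - 1) (subtopology (C I) (?c a))) (?r a)" if "a \<in> handles I" for a
  proof -
    obtain i T where a: "a = (i, T)" by fastforce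
    have "homology_group (p - 1) (subtopology (C I) (?c a)) \<cong> homology_group (p - 1) (conf (I - T - {i}) (subtopology X A) V)"
      using that unfolding a by (intro slab_homology[where v="1/4"]) auto
    then show ?thesis
      using rank[of "I - T - {i}" "p - 1"] free_of_rank_iso by (auto simp: a)
  qed
  have sub: "subtopology (subtopology (C I) ?M) (?c a) = subtopology (C I) (?c a)" if "a \<in> handles I" for a
    using that by (simp add: subtopology_subtopology Int_absorb1 UN_upper)
  have "(\<lambda>x. gfinprod (homology_group (p - 1) (subtopology (C I) ?M))
         (\<lambda>v. hom_induced (p - 1) (subtopology (subtopology (C I) ?M) v) {} (subtopology (C I) ?M) {} id (x v)) (?c ` handles I))
     \<in> iso (sum_group (?c ` handles I) (\<lambda>S. homology_group (p - 1) (subtopology (subtopology (C I) ?M) S)))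
           (homology_group (p - 1) (subtopology (C I) ?M))"
  proof (rule homology_additivity_axiom)
    show "pairwise disjnt (?c ` handles I)"
      using disj unfolding pairwise_def disjnt_def by blast
    show "\<Union> (?c ` handles I) = topspace (subtopology (C I) ?M)"
      using slab_topspace by (simp add: Int_absorb1 UN_subset_iff)
    fix v assume "v \<in> ?c ` handles I"
    then show "openin (subtopology (C I) ?M) v"
      using openin_slab[OF fin, of _ "{..<1/2}"] by (auto simp: openin_subtopology intro!: exI[of _ v])
  qed
  then have "sum_group (?c ` handles I) (\<lambda>S. homology_group (p - 1) (subtopology (subtopology (C I) ?M) S))
       \<cong> homology_group (p - 1) (subtopology (C I) ?M)"
    by (rule is_isoI)
  then have iso: "homology_group (p - 1) (subtopology (C I) ?M) \<cong>
      sum_group (?c ` handles I) (\<lambda>S. homology_group (p - 1) (subtopology (subtopology (C I) ?M) S))"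
    by (rule group.iso_sym[OF sum_group, rotated]) simp
  have "free_of_rank (sum_group (?c ` handles I) (\<lambda>S. homology_group (p - 1) (subtopology (subtopology (C I) ?M) S)))
      (\<Sum>S\<in>?c ` handles I. ?r (inv_into (handles I) ?c S))"
    using finite_handles[OF fin] rc inj by (intro free_of_rank_sum_group) (auto simp: sub)
  also have "(\<Sum>S\<in>?c ` handles I. ?r (inv_into (handles I) ?c S)) = (\<Sum>a\<in>handles I. ?r a)"
    using inj by (simp add: sum.reindex)
  finally have M: "free_of_rank (homology_group (p - 1) (subtopology (C I) ?M)) (\<Sum>a\<in>handles I. ?r a)"
    using free_of_rank_iso[OF iso] by blast
  have "free_of_rank (homology_group p (subtopology (C I) (base I))) (r I p)"
    using rank[of I p] by (simp add: conf_subtopology base_def)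
  from free_of_rank_DirProd[OF this M] show ?thesis
    using free_of_rank_iso[OF homology_conf_pendant_edge[OF fin]] by simp
qed

end

section \<open>One-dimensional complexes\<close>

lemma continuous_map_compose_continuous_on:
  assumes "continuous_map X euclidean f" "\<And>x. x \<in> topspace X \<Longrightarrow> f x \<in> S" "continuous_on S g"
  shows "continuous_map X euclidean (\<lambda>x. g (f x))"
proof -
  have "continuous_map X (top_of_set S) f" "continuous_map (top_of_set S) euclidean g"
    using assms by (auto simp: continuous_map_in_subtopology)
  from continuous_map_compose[OF this] show ?thesis by (simp add: o_def)
qed

lemma continuous_map_complex_mult:
  fixes f g :: "'a \<Rightarrow> complex"
  assumes "continuous_map X euclidean f" "continuous_map X euclidean g"
  shows "continuous_map X euclidean (\<lambda>x. f x * g x)"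
  using assms by (simp add: continuous_map_atin tendsto_mult)

text \<open>
  Two stages of the homotopy that are close to each other have a quotient in the right half plane,
  where the principal logarithm is continuous; by compactness of \<open>X\<close> the same closeness of times works
  for all points. So having a quotient that is an exponential is an equivalence relation on the times
  with open classes, and the interval is connected.
\<close>
lemma nullhomotopic_imp_continuous_log:
  assumes X: "compact_space X"
    and hom: "homotopic_with (\<lambda>_. True) X (top_of_set (- {0::complex})) f (\<lambda>_. c)"
    and ne: "topspace X \<noteq> {}"
  obtains g where "continuous_map X euclidean g" "\<And>x. x \<in> topspace X \<Longrightarrow> f x = exp (g x)"
proof -
  let ?I = "top_of_set {0..1::real}"
  obtain h where h: "continuous_map (prod_topology ?I X) (top_of_set (- {0})) h"
    "\<And>x. h (0, x) = f x" "\<And>x. h (1, x) = c"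
    using hom unfolding homotopic_with_def by blast
  have h0: "h (t, x) \<noteq> 0" if "t \<in> {0..1}" "x \<in> topspace X" for t x
    using h(1) that by (auto simp: continuous_map_in_subtopology Pi_iff)
  have h_cont: "continuous_map (prod_topology ?I X) euclidean h"
    using h(1) continuous_map_into_fulltopology by blast
  have hs: "continuous_map X euclidean (\<lambda>x. h (t, x))" if "t \<in> {0..1}" for t
  proof -
    have "continuous_map X (prod_topology ?I X) (\<lambda>x. (t, x))"
      using that by (auto simp: continuous_map_paired)
    from continuous_map_compose[OF this h_cont] show ?thesis by (simp add: o_def)
  qed
  define R where "R s t \<longleftrightarrow> (\<exists>g. continuous_map X (euclidean::complex topology) g \<and>
      (\<forall>x\<in>topspace X. h (s, x) = h (t, x) * exp (g x)))" for s t
  have "R 0 1"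
  proof (rule connected_equivalence_relation[of "{0..1::real}" 0 1 R])
    fix s t assume "R s t"
    then obtain g where g: "continuous_map X (euclidean::complex topology) g" "\<forall>x\<in>topspace X. h (s, x) = h (t, x) * exp (g x)"
      unfolding R_def by blast
    have "continuous_map X euclidean (\<lambda>x. - g x)" "\<forall>x\<in>topspace X. h (t, x) = h (s, x) * exp (- g x)"
      using g by (auto intro: continuous_map_minus simp: exp_minus)
    then show "R t s" unfolding R_def by blast
  next
    fix s t u assume "R s t" "R t u"
    then obtain g g' where g: "continuous_map X (euclidean::complex topology) g" "\<forall>x\<in>topspace X. h (s, x) = h (t, x) * exp (g x)"
      "continuous_map X (euclidean::complex topology) g'" "\<forall>x\<in>topspace X. h (t, x) = h (u, x) * exp (g' x)"
      unfolding R_def by blast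
    have "continuous_map X euclidean (\<lambda>x. g x + g' x)" "\<forall>x\<in>topspace X. h (s, x) = h (u, x) * exp (g x + g' x)"
      using g by (auto intro: continuous_map_add simp: exp_add)
    then show "R s u" unfolding R_def by blast
  next
    fix t :: real assume t: "t \<in> {0..1}"
    \<comment> \<open>The condition says that the quotient of the two values lies in the right half plane.\<close>
    let ?W = "{z \<in> topspace (prod_topology ?I X). 0 < Re (h (t, snd z) * cnj (h z))}"
    have hsnd: "continuous_map (prod_topology ?I X) euclidean (\<lambda>z. h (t, snd z))"
      using continuous_map_compose[OF continuous_map_snd hs[OF t]] by (simp add: o_def)
    have "continuous_map (prod_topology ?I X) euclideanreal (\<lambda>z. Re (h (t, snd z) * cnj (h z)))"
      by (intro continuous_map_compose_continuous_on[where g=Re and S=UNIV] continuous_map_complex_mult hsnd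
          continuous_map_compose_continuous_on[OF h_cont, of UNIV cnj]) (auto intro: continuous_intros)
    then have W: "openin (prod_topology ?I X) ?W"
      by (rule openin_Collect_less[rotated]) simp
    have "{t} \<times> topspace X \<subseteq> ?W"
    proof
      fix z assume "z \<in> {t} \<times> topspace X"
      then obtain x where x: "z = (t, x)" "x \<in> topspace X" by auto
      show "z \<in> ?W"
        using x t h0[OF t x(2)] by (auto simp: sum_squares_gt_zero_iff complex_eq_iff)
    qed
    then obtain U V where UV: "openin ?I U" "t \<in> U" "topspace X \<subseteq> V" "U \<times> V \<subseteq> ?W"
      using tube_lemma_right[OF W, of "topspace X" t] X t by (auto simp: compact_space_def)
    have "R t s" if "s \<in> U" for s
    proof -
      have s: "s \<in> {0..1}" using openin_subset[OF UV(1)] that by auto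
      let ?q = "\<lambda>x. h (t, x) * cnj (h (s, x))"
      \<comment> \<open>As the product with the conjugate replaces the quotient, the squared modulus is divided out.\<close>
      let ?g = "\<lambda>x. Ln (?q x) - of_real (ln ((cmod (h (s, x)))\<^sup>2))"
      have pos: "0 < Re (?q x)" if x: "x \<in> topspace X" for x
      proof -
        have "(s, x) \<in> U \<times> V" using UV(3) x \<open>s \<in> U\<close> by blast
        then have "(s, x) \<in> ?W" using UV(4) by blast
        then show ?thesis by simp
      qed
      have "continuous_map X euclidean ?g"
      proof -
        have "continuous_map X euclidean ?q"
          by (intro continuous_map_complex_mult hs t
              continuous_map_compose_continuous_on[OF hs[OF s], of UNIV cnj]) (auto intro: continuous_intros)
        then have "continuous_map X euclidean (\<lambda>x. Ln (?q x))"
          by (rule continuous_map_compose_continuous_on[where S="{z. 0 < Re z}" and g=Ln])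
            (use pos in \<open>auto intro!: continuous_intros simp: complex_nonpos_Reals_iff\<close>)
        moreover have "continuous_map X euclidean (\<lambda>x. complex_of_real (ln ((cmod (h (s, x)))\<^sup>2)))"
          using h0[OF s] by (intro continuous_map_compose_continuous_on[OF hs[OF s], where S="- {0}"])
            (auto intro!: continuous_intros)
        ultimately show ?thesis by (rule continuous_map_diff)
      qed
      moreover have "h (t, x) = h (s, x) * exp (?g x)" if x: "x \<in> topspace X" for x
      proof -
        have n: "h (s, x) \<noteq> 0" using h0[OF s x] .
        have "?q x \<noteq> 0" using pos[OF x] by force
        then have "exp (?g x) = ?q x / of_real ((cmod (h (s, x)))\<^sup>2)"
          using n by (simp add: exp_diff exp_Ln exp_of_real)
        also have "of_real ((cmod (h (s, x)))\<^sup>2) = h (s, x) * cnj (h (s, x))"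
          by (rule complex_norm_square)
        finally show ?thesis using n by simp
      qed
      ultimately show ?thesis unfolding R_def by blast
    qed
    then show "\<exists>T. openin ?I T \<and> t \<in> T \<and> (\<forall>x\<in>T. R t x)"
      using UV by blast
  qed auto
  then obtain g where g: "continuous_map X (euclidean::complex topology) g" "\<forall>x\<in>topspace X. f x = c * exp (g x)"
    unfolding R_def by (auto simp: h)
  obtain x where "x \<in> topspace X" using ne by blast
  then have "c \<noteq> 0" using h0[of 1 x] h(3) by auto
  show ?thesis
  proof
    show "continuous_map X euclidean (\<lambda>x. g x + Ln c)"
      using g(1) by (intro continuous_map_add) auto
    show "f x = exp (g x + Ln c)" if "x \<in> topspace X" for x
      using g(2) that \<open>c \<noteq> 0\<close> by (simp add: exp_add)
  qed
qed

text \<open>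
  The solutions of \<open>exp z = 1\<close> are discrete.
\<close>
lemma exp_1_connected_constant:
  assumes "connected T" "\<And>z. z \<in> T \<Longrightarrow> exp z = (1::complex)" "z \<in> T" "w \<in> T"
  shows "z = w"
proof -
  have "id constant_on T"
  proof (rule continuous_discrete_range_constant[OF assms(1)])
    fix x assume x: "x \<in> T"
    have "1 \<le> norm (y - x)" if "y \<in> T" "y \<noteq> x" for y
    proof -
      have "exp (y - x) = 1" using assms(2) that x by (simp add: exp_diff)
      then obtain n :: int where n: "Re (y - x) = 0" "Im (y - x) = of_int (2 * n) * pi"
        unfolding exp_eq_1 by auto
      have "n \<noteq> 0" using n that by (auto simp: complex_eq_iff)
      then have "1 \<le> \<bar>real_of_int (2 * n)\<bar>" by linarith
      then have "1 * 1 \<le> \<bar>real_of_int (2 * n)\<bar> * pi" using pi_gt3 by (intro mult_mono) auto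
      also have "\<dots> = \<bar>Im (y - x)\<bar>" unfolding n(2) by (simp add: abs_mult)
      also have "\<dots> \<le> norm (y - x)" by (rule abs_Im_le_cmod)
      finally show ?thesis by simp
    qed
    then show "\<exists>e>0. \<forall>y. y \<in> T \<and> id y \<noteq> id x \<longrightarrow> e \<le> norm (id y - id x)"
      by (intro exI[of _ 1]) auto
  qed auto
  then obtain y where "\<And>x. x \<in> T \<Longrightarrow> x = y" by (auto simp: constant_on_def)
  then show ?thesis using assms(3,4) by metis
qed

locale graph_space =
  fixes X :: "'a topology" and V :: "'a set" and E :: "'a set set"
  assumes graph: "CW_graph X V E"
begin

lemma cw: "Hausdorff_space X" "V \<union> \<Union>E = topspace X" "V \<inter> \<Union>E = {}" "pairwise disjnt E"
    "e \<in> E \<Longrightarrow> \<exists>\<phi>. characteristic_map X V e \<phi>"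
    "S \<subseteq> topspace X \<Longrightarrow> (\<And>e. e \<in> E \<Longrightarrow> closedin X (S \<inter> X closure_of e)) \<Longrightarrow> closedin X S"
    "compact_space X" "connected_space X" "topspace X \<noteq> {}"
  using graph unfolding CW_graph_def CW_complex_1_def by blast+

lemma edges_disjoint: "e \<in> E \<Longrightarrow> e' \<in> E \<Longrightarrow> e \<noteq> e' \<Longrightarrow> e \<inter> e' = {}"
  using cw(4) by (auto simp: pairwise_def disjnt_def)

lemma charmap:
  assumes e: "e \<in> E" and \<phi>: "characteristic_map X V e \<phi>"
  shows "\<phi> ` {0<..<1} = e" "inj_on \<phi> {0<..<1}" "\<phi> 0 \<in> V" "\<phi> 1 \<in> V"
    "continuous_map (top_of_set {0..1}) X \<phi>" "\<phi> ` {0..1} = e \<union> {\<phi> 0, \<phi> 1}"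
    "closed C \<Longrightarrow> closedin X (\<phi> ` ({0..1} \<inter> C))" "X closure_of e \<subseteq> e \<union> {\<phi> 0, \<phi> 1}"
    "connectedin X (\<phi> ` {0..1})" "connectedin X e"
proof -
  have sub: "e \<subseteq> topspace X" using e cw(2) by auto
  show im: "\<phi> ` {0<..<1} = e" and "inj_on \<phi> {0<..<1}" and "\<phi> 0 \<in> V" "\<phi> 1 \<in> V"
    and cont: "continuous_map (top_of_set {0..1}) X \<phi>"
    using \<phi> sub unfolding characteristic_map_def homeomorphic_eq_everything_map by (auto simp: Int_absorb1)
  have "{0..1::real} = {0<..<1} \<union> {0, 1}" by auto
  then show imc: "\<phi> ` {0..1} = e \<union> {\<phi> 0, \<phi> 1}"
    using im by (metis image_Un image_insert image_empty)
  show closed: "closedin X (\<phi> ` ({0..1} \<inter> C))" if "closed C" for C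
  proof -
    have "compactin (top_of_set {0..1}) ({0..1} \<inter> C)"
      using that by (simp add: compactin_subtopology compact_Int_closed)
    then show ?thesis
      using cont image_compactin compactin_imp_closedin cw(1) by blast
  qed
  show "X closure_of e \<subseteq> e \<union> {\<phi> 0, \<phi> 1}"
    using closed[of UNIV] imc by (intro closure_of_minimal) auto
  have "connectedin (top_of_set {0..1}) {0..1::real}" "connectedin (top_of_set {0..1}) {0<..<1::real}"
    by (auto simp: connectedin_subtopology)
  then show "connectedin X (\<phi> ` {0..1})" "connectedin X e"
    using connectedin_continuous_map_image[OF cont] im by metis+
qed

text \<open>
  The closure of an edge adds at most two points, and finite sets are closed; so this is the weak
  topology.
\<close>
lemma closedin_if_finite_traces:
  assumes "S \<subseteq> topspace X" "\<And>e. e \<in> E \<Longrightarrow> finite (S \<inter> e)"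
  shows "closedin X S"
proof (rule cw(6)[OF assms(1)])
  fix e assume e: "e \<in> E"
  then obtain \<phi> where "characteristic_map X V e \<phi>" using cw(5) by blast
  then have "S \<inter> X closure_of e \<subseteq> (S \<inter> e) \<union> {\<phi> 0, \<phi> 1}" using charmap(8)[OF e] by blast
  then have "finite (S \<inter> X closure_of e)" using assms(2)[OF e] finite_subset by blast
  then show "closedin X (S \<inter> X closure_of e)"
    using assms(1) cw(1) by (intro closedin_Hausdorff_finite) auto
qed

lemma closedin_vertices: "S \<subseteq> V \<Longrightarrow> closedin X S"
proof (rule closedin_if_finite_traces)
  assume S: "S \<subseteq> V"
  then show "S \<subseteq> topspace X" using cw(2) by blast
  fix e assume "e \<in> E"
  then have "S \<inter> e = {}" using S cw(3) by blast
  then show "finite (S \<inter> e)" by simp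
qed

lemma connected_vertices: "S \<subseteq> V \<Longrightarrow> connectedin X S \<Longrightarrow> x \<in> S \<Longrightarrow> S = {x}"
proof (rule ccontr)
  assume S: "S \<subseteq> V" "connectedin X S" "x \<in> S" "S \<noteq> {x}"
  have "closedin X {x}" "closedin X (S - {x})" using S by (auto intro!: closedin_vertices)
  moreover have "S \<subseteq> {x} \<union> (S - {x})" "{x} \<inter> (S - {x}) \<inter> S = {}" "{x} \<inter> S \<noteq> {}" "(S - {x}) \<inter> S \<noteq> {}"
    using S by auto
  ultimately show False using S(2) unfolding connectedin_closedin by blast
qed

text \<open>
  One point from each edge gives a closed discrete subset of a compact space.
\<close>
lemma finite_edges: "finite E"
proof -
  have "\<exists>x. x \<in> e" if e: "e \<in> E" for e
  proof -
    obtain \<phi> where "characteristic_map X V e \<phi>" using cw(5)[OF e] by blast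
    then have "\<phi> (1/2) \<in> e" using charmap(1)[OF e] by force
    then show ?thesis by blast
  qed
  then obtain p where p: "\<And>e. e \<in> E \<Longrightarrow> p e \<in> e" by metis
  have closed: "closedin X S" if "S \<subseteq> p ` E" for S
  proof (rule closedin_if_finite_traces)
    show "S \<subseteq> topspace X" using that p cw(2) by blast
    fix e assume e: "e \<in> E"
    have "S \<inter> e \<subseteq> {p e}" using that p e edges_disjoint by blast
    then show "finite (S \<inter> e)" using finite_subset by blast
  qed
  have sub: "p ` E \<subseteq> topspace X" using closedin_subset[OF closed[of "p ` E"]] by simp
  have "subtopology X (p ` E) = discrete_topology (p ` E)"
  proof (rule discrete_topology_unique[THEN iffD2, symmetric], intro conjI ballI)
    show "topspace (subtopology X (p ` E)) = p ` E" using sub by (simp add: Int_absorb1)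
    fix x assume x: "x \<in> p ` E"
    have "p ` E \<inter> (topspace X - (p ` E - {x})) = {x}" using x sub by auto
    moreover have "openin X (topspace X - (p ` E - {x}))" using closed[of "p ` E - {x}"] by auto
    ultimately show "openin (subtopology X (p ` E)) {x}"
      unfolding openin_subtopology by (metis inf_commute)
  qed
  moreover have "compact_space (subtopology X (p ` E))"
    using closed[of "p ` E"] cw(7) closedin_compact_space compact_space_subtopology by blast
  ultimately have "finite (p ` E)" by (simp add: compact_space_discrete_topology)
  moreover have "inj_on p E"
    by (intro inj_onI) (metis p edges_disjoint disjoint_iff)
  ultimately show ?thesis using finite_imageD by blast
qed

lemma closedin_edge_complement:
  assumes "e \<in> E" shows "closedin X (topspace X - e)"
proof (rule cw(6))
  fix e' assume e': "e' \<in> E"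
  then obtain \<phi> where \<phi>: "characteristic_map X V e' \<phi>" using cw(5) by blast
  show "closedin X ((topspace X - e) \<inter> X closure_of e')"
  proof (cases "e' = e")
    case True
    then have "(topspace X - e) \<inter> X closure_of e' \<subseteq> {\<phi> 0, \<phi> 1}"
      using charmap(8)[OF e' \<phi>] by blast
    then show ?thesis using cw(1) finite_subset by (intro closedin_Hausdorff_finite) auto
  next
    case False
    have "e \<inter> X closure_of e' = {}"
      using charmap(8,3,4)[OF e' \<phi>] edges_disjoint[OF assms e'] False cw(3) assms by blast
    then have "(topspace X - e) \<inter> X closure_of e' = X closure_of e'"
      using closure_of_subset_topspace by fast
    then show ?thesis by simp
  qed
qed auto

end

section \<open>Every tree has a leaf\<close>

lemma characteristic_map_reverse:
  assumes "characteristic_map X V e \<phi>"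
  shows "characteristic_map X V e (\<lambda>t. \<phi> (1 - t))"
proof -
  have "continuous_map (top_of_set {0..1}) (top_of_set {0..1::real}) (\<lambda>t. 1 - t)"
    by (auto intro: continuous_intros)
  moreover have "homeomorphic_map (top_of_set {0<..<1}) (top_of_set {0<..<1::real}) (\<lambda>t. 1 - t)"
    unfolding homeomorphic_map_maps homeomorphic_maps_def
    by (intro exI[of _ "\<lambda>t. 1 - t"]) (auto intro: continuous_intros)
  ultimately have "continuous_map (top_of_set {0..1}) X (\<phi> \<circ> (\<lambda>t. 1 - t))"
      "homeomorphic_map (top_of_set {0<..<1}) (subtopology X e) (\<phi> \<circ> (\<lambda>t. 1 - t))"
    using assms by (auto simp: characteristic_map_def intro!: continuous_map_compose homeomorphic_map_compose)
  then show ?thesis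
    using assms by (simp add: characteristic_map_def o_def)
qed

context graph_space
begin

text \<open>
  If the complement \<open>R\<close> of the edge is connected, collapse it and wrap the edge once around the
  circle. A logarithm \<open>g\<close> of this map \<open>f\<close> is constant on \<open>R\<close>, so it takes the same value at the two ends of
  the edge, but along the edge it increases by \<open>2 * pi * \<i>\<close>.
\<close>
lemma edge_complement_disconnected:
  assumes "contractible_space X" and e: "e \<in> E" and \<phi>: "characteristic_map X V e \<phi>"
  shows "\<not> connectedin X (topspace X - e)"
proof
  define R where "R = topspace X - e"
  assume "connectedin X (topspace X - e)"
  then have conn: "connectedin X R" by (simp add: R_def)
  note c = charmap[OF e \<phi>]
  have clR: "closedin X R" unfolding R_def by (rule closedin_edge_complement[OF e])
  have endsR: "\<phi> 0 \<in> R" "\<phi> 1 \<in> R" using c(3,4) cw(2,3) e by (auto simp: R_def)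
  define w where "w t = exp (2 * pi * \<i> * complex_of_real t)" for t :: real
  define f where "f x = (if x \<in> R then 1 else w (inv_into {0<..<1} \<phi> x))" for x
  have w01: "w 0 = 1" "w 1 = 1" by (auto simp: w_def)
  have f\<phi>: "f (\<phi> t) = w t" if "t \<in> {0..1}" for t
  proof (cases "t = 0 \<or> t = 1")
    case True then show ?thesis using endsR w01 by (auto simp: f_def)
  next
    case False
    then have t: "t \<in> {0<..<1}" using that by auto
    then have "\<phi> t \<in> e" using c(1) by auto
    then show ?thesis using c(2) t by (simp add: f_def R_def)
  qed
  have cover: "x \<in> R \<or> (\<exists>t\<in>{0..1}. x = \<phi> t)" if "x \<in> topspace X" for x
    using that c(6) by (auto simp: R_def)
  have contw: "continuous_on UNIV w" unfolding w_def by (intro continuous_intros)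
  have "closedin X {x \<in> topspace X. f x \<in> C}" if "closed C" for C
  proof -
    have "{x \<in> topspace X. f x \<in> C} = (if 1 \<in> C then R else {}) \<union> \<phi> ` ({0..1} \<inter> (w -` C))"
    proof (intro subset_antisym subsetI)
      fix x assume x: "x \<in> {x \<in> topspace X. f x \<in> C}"
      then consider "x \<in> R" | t where "t \<in> {0..1}" "x = \<phi> t" using cover by blast
      then show "x \<in> (if 1 \<in> C then R else {}) \<union> \<phi> ` ({0..1} \<inter> (w -` C))"
      proof cases
        case 1 then show ?thesis using x by (auto simp: f_def)
      next
        case 2 then show ?thesis using x f\<phi>[of t] by auto
      qed
    next
      fix x assume x: "x \<in> (if 1 \<in> C then R else {}) \<union> \<phi> ` ({0..1} \<inter> (w -` C))"
      then consider "1 \<in> C" "x \<in> R" | t where "t \<in> {0..1}" "x = \<phi> t" "w t \<in> C" by (auto split: if_splits)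
      then show "x \<in> {x \<in> topspace X. f x \<in> C}"
      proof cases
        case 1 then show ?thesis by (auto simp: f_def R_def)
      next
        case 2
        have "\<phi> t \<in> topspace X" using 2(1) continuous_map_image_subset_topspace[OF c(5)] by auto
        then show ?thesis using 2 f\<phi>[of t] by auto
      qed
    qed
    moreover have "closed (w -` C)"
      using contw that by (simp add: continuous_closed_vimage continuous_on_eq_continuous_at)
    ultimately show ?thesis using clR c(7) by auto
  qed
  then have "continuous_map X euclidean f"
    by (auto simp: continuous_map_closedin)
  moreover have "f x \<noteq> 0" for x by (simp add: f_def w_def)
  ultimately have "continuous_map X (top_of_set (- {0})) f"
    by (auto simp: continuous_map_in_subtopology)
  then obtain c0 where "homotopic_with (\<lambda>_. True) X (top_of_set (- {0})) f (\<lambda>_. c0)"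
    using nullhomotopic_from_contractible_space assms(1) by blast
  then obtain g where g: "continuous_map X euclidean g" "\<And>x. x \<in> topspace X \<Longrightarrow> f x = exp (g x)"
    using nullhomotopic_imp_continuous_log cw(7,9) by blast
  have RX: "R \<subseteq> topspace X" by (auto simp: R_def)
  have 1: "g (\<phi> 0) = g (\<phi> 1)"
  proof (rule exp_1_connected_constant[of "g ` R"])
    show "connected (g ` R)"
      using connectedin_continuous_map_image[OF g(1) conn] by simp
    show "exp z = 1" if z: "z \<in> g ` R" for z
    proof -
      obtain x where x: "x \<in> R" "z = g x" using z by blast
      then have "f x = exp z" using g(2) RX by blast
      then show ?thesis using x(1) by (simp add: f_def)
    qed
  qed (use endsR in auto)
  let ?k = "\<lambda>t. g (\<phi> t) - 2 * pi * \<i> * complex_of_real t"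
  have "?k 0 = ?k 1"
  proof (rule exp_1_connected_constant[of "?k ` {0..1}"])
    have "continuous_map (top_of_set {0..1}) euclidean (g \<circ> \<phi>)"
      using continuous_map_compose[OF c(5) g(1)] .
    then have "continuous_on {0..1} (\<lambda>t. g (\<phi> t))" by (simp add: o_def)
    then have "continuous_on {0..1} ?k" by (intro continuous_intros)
    then show "connected (?k ` {0..1})" by (intro connected_continuous_image) auto
    show "exp z = 1" if z: "z \<in> ?k ` {0..1}" for z
    proof -
      obtain t where t: "t \<in> {0..1}" "z = ?k t" using z by auto
      have "\<phi> t \<in> topspace X" using t(1) continuous_map_image_subset_topspace[OF c(5)] by auto
      then have "exp (g (\<phi> t)) = w t" using g(2) f\<phi>[OF t(1)] by simp
      then show ?thesis by (simp add: t(2) exp_diff w_def)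
    qed
  qed (rule imageI, simp)+
  then show False using 1 by simp
qed

text \<open>
  The edge \<open>e\<close> separates the graph into the pieces \<open>A\<close> and \<open>B\<close>, and \<open>\<phi>\<close> runs from \<open>A\<close> to \<open>B\<close>.
\<close>
definition split_by :: "'a set \<Rightarrow> 'a set \<Rightarrow> 'a set \<Rightarrow> (real \<Rightarrow> 'a) \<Rightarrow> bool" where
  "split_by e A B \<phi> \<longleftrightarrow> characteristic_map X V e \<phi> \<and> closedin X A \<and> closedin X B \<and> A \<inter> B = {} \<and>
     A \<union> B = topspace X - e \<and> \<phi> 0 \<in> A \<and> \<phi> 1 \<in> B"

lemma split_by_sym: "split_by e A B \<phi> \<Longrightarrow> split_by e B A (\<lambda>t. \<phi> (1 - t))"
  using characteristic_map_reverse by (auto simp: split_by_def)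

text \<open>
  In a separation of the complement of the edge, the two ends of the edge cannot be on the same side,
  since then the other side would be separated from the rest of the graph.
\<close>
lemma split_by_exists:
  assumes "contractible_space X" and e: "e \<in> E"
  obtains A B \<phi> where "split_by e A B \<phi>"
proof -
  obtain \<phi> where \<phi>: "characteristic_map X V e \<phi>" using cw(5)[OF e] by blast
  note c = charmap[OF e \<phi>]
  let ?R = "topspace X - e"
  obtain S T where ST: "closedin X S" "closedin X T" "?R \<subseteq> S \<union> T" "S \<inter> T \<inter> ?R = {}" "S \<inter> ?R \<noteq> {}" "T \<inter> ?R \<noteq> {}"
    using edge_complement_disconnected[OF assms \<phi>] unfolding connectedin_closedin by blast
  define A where "A = S \<inter> ?R"
  define B where "B = T \<inter> ?R"
  have AB: "closedin X A" "closedin X B" "A \<inter> B = {}" "A \<union> B = ?R" "A \<noteq> {}" "B \<noteq> {}"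
    using ST closedin_edge_complement[OF e] by (auto simp: A_def B_def)
  have ends: "\<phi> 0 \<in> A \<union> B" "\<phi> 1 \<in> A \<union> B"
    using c(3,4) cw(2,3) e unfolding AB(4) by auto
  have closed: "closedin X (\<phi> ` {0..1})" using c(7)[of UNIV] by simp
  have not_same: "\<not> (\<phi> 0 \<in> P \<and> \<phi> 1 \<in> P)"
    if P: "closedin X P" "closedin X Q" "P \<inter> Q = {}" "P \<union> Q = ?R" "Q \<noteq> {}" for P Q
  proof
    assume "\<phi> 0 \<in> P \<and> \<phi> 1 \<in> P"
    then have "topspace X \<subseteq> (P \<union> \<phi> ` {0..1}) \<union> Q" "(P \<union> \<phi> ` {0..1}) \<inter> Q = {}"
      using P c(6) by auto
    moreover have "closedin X (P \<union> \<phi> ` {0..1})" using P closed by auto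
    moreover have "P \<union> \<phi> ` {0..1} \<noteq> {}" by auto
    ultimately show False using cw(8) P unfolding connected_space_closedin by blast
  qed
  show ?thesis
  proof (cases "\<phi> 0 \<in> A")
    case True
    then have "split_by e A B \<phi>"
      using not_same[of A B] AB ends \<phi> by (auto simp: split_by_def)
    then show ?thesis by (rule that)
  next
    case False
    then have "split_by e B A \<phi>"
      using not_same[of B A] AB ends \<phi> by (auto simp: split_by_def)
    then show ?thesis by (rule that)
  qed
qed

text \<open>
  In a separation of \<open>A\<close>, the part without \<open>\<phi> 0\<close> would be separated from the rest of the graph.
\<close>
lemma split_by_connected:
  assumes e: "e \<in> E" and s: "split_by e A B \<phi>"
  shows "connectedin X A"
  unfolding connectedin_closedin
proof (intro conjI notI)
  have \<phi>: "characteristic_map X V e \<phi>" and AB: "closedin X A" "closedin X B" "A \<inter> B = {}"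
     "A \<union> B = topspace X - e" "\<phi> 0 \<in> A" "\<phi> 1 \<in> B"
    using s by (auto simp: split_by_def)
  note c = charmap[OF e \<phi>]
  show "A \<subseteq> topspace X" using AB by blast
  have closed: "closedin X (\<phi> ` {0..1})" using c(7)[of UNIV] by simp
  have no: False if "closedin X P" "closedin X Q" "A \<subseteq> P \<union> Q" "P \<inter> Q \<inter> A = {}" "Q \<inter> A \<noteq> {}" "\<phi> 0 \<in> P" for P Q
  proof -
    let ?P = "(P \<inter> A) \<union> \<phi> ` {0..1} \<union> B" and ?Q = "Q \<inter> A"
    have "closedin X (P \<inter> A)" "closedin X ?Q"
      using that(1,2) AB(1) by (auto intro: closedin_Int)
    moreover from this have "closedin X ?P"
      using closed AB(2) by (intro closedin_Un)
    moreover have "topspace X \<subseteq> ?P \<union> ?Q" using that(3) AB(4) c(6) by blast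
    moreover have "?P \<inter> ?Q = {}"
    proof -
      have "e \<inter> A = {}" using AB(4) by blast
      moreover have "\<phi> 0 \<notin> Q" using that AB(5) by blast
      moreover have "\<phi> 1 \<notin> A" using AB by blast
      ultimately show ?thesis unfolding c(6) using that(4) AB(3) by blast
    qed
    moreover have "?P \<noteq> {}" by auto
    ultimately show False using cw(8) that(5) unfolding connected_space_closedin by blast
  qed
  assume "\<exists>E1 E2. closedin X E1 \<and> closedin X E2 \<and> A \<subseteq> E1 \<union> E2 \<and> E1 \<inter> E2 \<inter> A = {} \<and> E1 \<inter> A \<noteq> {} \<and> E2 \<inter> A \<noteq> {}"
  then obtain P Q where PQ: "closedin X P" "closedin X Q" "A \<subseteq> P \<union> Q" "P \<inter> Q \<inter> A = {}" "P \<inter> A \<noteq> {}" "Q \<inter> A \<noteq> {}"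
    by blast
  then show False
    using no[of P Q] no[of Q P] AB(5) by blast
qed

lemma connectedin_split_cases:
  assumes "split_by e A B \<phi>" "connectedin X S" "S \<subseteq> topspace X - e"
  shows "S \<subseteq> A \<or> S \<subseteq> B"
proof -
  have "closedin X A" "closedin X B" "A \<inter> B = {}" "A \<union> B = topspace X - e"
    using assms(1) by (auto simp: split_by_def)
  then have "A \<inter> S = {} \<or> B \<inter> S = {}"
    using assms(2,3) unfolding connectedin_closedin by blast
  then show ?thesis using assms(3) \<open>A \<union> B = topspace X - e\<close> by blast
qed

lemma edge_subset_complement: "e \<in> E \<Longrightarrow> e' \<in> E \<Longrightarrow> e \<noteq> e' \<Longrightarrow> e' \<subseteq> topspace X - e"
proof -
  assume e: "e \<in> E" "e' \<in> E" "e \<noteq> e'"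
  then have "e' \<subseteq> topspace X" using cw(2) by blast
  then show ?thesis using edges_disjoint[OF e] by blast
qed

lemma edge_ne: "e \<in> E \<Longrightarrow> e \<noteq> {}"
proof -
  assume e: "e \<in> E"
  then obtain \<phi> where "characteristic_map X V e \<phi>" using cw(5) by blast
  from charmap(1)[OF e this] show "e \<noteq> {}" by force
qed

text \<open>
  Choose an edge and a side \<open>B\<close> of it with the fewest edges. If \<open>B\<close> contained an edge \<open>e'\<close>, then
  the other side together with the chosen edge, being connected, would lie on one side of \<open>e'\<close>, and the remaining side of
  \<open>e'\<close> would be part of \<open>B\<close> without \<open>e'\<close>. So \<open>B\<close> consists of vertices, and as it is connected it is a single one.
\<close>
lemma leaf_exists:
  assumes contr: "contractible_space X" and "E \<noteq> {}"
  obtains e A \<phi> where "e \<in> E" "split_by e A {\<phi> 1} \<phi>"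
proof -
  define P where "P n \<longleftrightarrow> (\<exists>e\<in>E. \<exists>A B \<phi>. split_by e A B \<phi> \<and> card {e'\<in>E. e' \<subseteq> B} = n)" for n
  obtain e\<^sub>0 where e0: "e\<^sub>0 \<in> E" using assms(2) by blast
  obtain A\<^sub>0 B\<^sub>0 \<phi>\<^sub>0 where "split_by e\<^sub>0 A\<^sub>0 B\<^sub>0 \<phi>\<^sub>0" using split_by_exists[OF contr e0] .
  with e0 have "\<exists>n. P n"
    unfolding P_def by blast
  then have least: "P (LEAST n. P n)"
    by (rule LeastI_ex)
  then obtain e A B \<phi> where e: "e \<in> E" and s: "split_by e A B \<phi>" and card: "card {e'\<in>E. e' \<subseteq> B} = (LEAST n. P n)"
    unfolding P_def by blast
  have AB: "characteristic_map X V e \<phi>" "A \<inter> B = {}" "A \<union> B = topspace X - e" "\<phi> 0 \<in> A" "\<phi> 1 \<in> B"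
    using s by (auto simp: split_by_def)
  note c = charmap[OF e AB(1)]
  have none: "\<not> e' \<subseteq> B" if e': "e' \<in> E" for e'
  proof
    assume e'B: "e' \<subseteq> B"
    then have ne: "e' \<noteq> e" using AB edge_ne[OF e] by blast
    \<comment> \<open>Everything outside B, up to the end of the edge that lies in B.\<close>
    let ?D = "A \<union> \<phi> ` {0..1}"
    have D: "connectedin X ?D"
      using split_by_connected[OF e s] c(9) AB(4) by (intro connectedin_Un) auto
    have "\<phi> 0 \<notin> e'" "\<phi> 1 \<notin> e'" using c(3,4) cw(3) e' by auto
    then have De': "?D \<subseteq> topspace X - e'"
      using e'B AB edges_disjoint[OF e e'] ne connectedin_subset_topspace[OF D] unfolding c(6) by blast
    obtain A0 B0 \<phi>0 where s0: "split_by e' A0 B0 \<phi>0" using split_by_exists[OF contr e'] .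
    obtain A' B' \<phi>' where s': "split_by e' A' B' \<phi>'" and DA': "?D \<subseteq> A'"
      using connectedin_split_cases[OF s0 D De'] s0 split_by_sym[OF s0] by blast
    have AB': "A' \<inter> B' = {}" "A' \<union> B' = topspace X - e'" using s' by (auto simp: split_by_def)
    have "B' \<subseteq> topspace X - ?D" using AB' DA' by blast
    also have "\<dots> \<subseteq> B" using AB(3) c(6) by blast
    finally have "B' \<subseteq> B" .
    moreover have "\<not> e' \<subseteq> B'" using AB' edge_ne[OF e'] by blast
    ultimately have "{e''\<in>E. e'' \<subseteq> B'} \<subset> {e''\<in>E. e'' \<subseteq> B}" using e' e'B by blast
    then have "card {e''\<in>E. e'' \<subseteq> B'} < card {e''\<in>E. e'' \<subseteq> B}"
      using finite_edges by (intro psubset_card_mono) auto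
    moreover have "P (card {e''\<in>E. e'' \<subseteq> B'})" unfolding P_def using e' s' by blast
    ultimately show False using Least_le[of P] card by fastforce
  qed
  have "x \<in> V" if x: "x \<in> B" for x
  proof (rule ccontr)
    assume "x \<notin> V"
    then obtain e' where e': "e' \<in> E" "x \<in> e'" using x AB(3) cw(2) by blast
    then have "e' \<noteq> e" using x AB(3) by blast
    then have "e' \<subseteq> A \<or> e' \<subseteq> B"
      using connectedin_split_cases[OF s] charmap(10)[OF e'(1)] cw(5)[OF e'(1)] edge_subset_complement[OF e e'(1)] by blast
    then show False using none[OF e'(1)] e'(2) x AB(2) by blast
  qed
  then have "B = {\<phi> 1}"
    using connected_vertices[of B "\<phi> 1"] split_by_connected[OF e split_by_sym[OF s]] AB(5) by blast
  then show ?thesis using that e s by blast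
qed

lemma leaf_pendant_edge:
  assumes e: "e \<in> E" and s: "split_by e A {\<phi> 1} \<phi>"
  shows "pendant_edge X V A \<phi>"
proof -
  have AB: "characteristic_map X V e \<phi>" "closedin X A" "A \<inter> {\<phi> 1} = {}" "A \<union> {\<phi> 1} = topspace X - e" "\<phi> 0 \<in> A"
    using s by (auto simp: split_by_def)
  note c = charmap[OF e AB(1)]
  have Ae: "A \<inter> e = {}" using AB(4) by blast
  have Ve: "V \<inter> e = {}" using cw(3) e by blast
  show ?thesis
  proof
    show "inj_on \<phi> {0..1}"
    proof -
      have "{0..1::real} = insert 0 (insert 1 {0<..<1})" by auto
      moreover have "\<phi> 0 \<notin> e" "\<phi> 1 \<notin> e" "\<phi> 0 \<noteq> \<phi> 1" using AB Ae by blast+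
      ultimately show ?thesis using c(1,2) by (simp add: inj_on_insert)
    qed
    have "e \<subseteq> topspace X" using e cw(2) by blast
    then have "topspace X = A \<union> {\<phi> 1} \<union> e" using AB(4) by blast
    then show "topspace X = A \<union> \<phi> ` {0..1}" using AB(5) by (auto simp: c(6))
    show "A \<inter> \<phi> ` {0..1} = {\<phi> 0}" using Ae AB(3,5) by (auto simp: c(6))
    show "V \<inter> \<phi> ` {0..1} = {\<phi> 0, \<phi> 1}" using Ve c(3,4) by (auto simp: c(6))
  qed (fact cw(1) AB(2) c(5))+
qed

text \<open>
  Contractibility passes to the smaller tree because it is a retract: slide the pendant edge back.
\<close>
lemma leaf_removal_tree:
  assumes contr: "contractible_space X" and e: "e \<in> E" and s: "split_by e A {\<phi> 1} \<phi>"
  shows "CW_tree (subtopology X A) (V \<inter> A) (E - {e})"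
proof -
  have AB: "characteristic_map X V e \<phi>" "closedin X A" "A \<inter> {\<phi> 1} = {}" "A \<union> {\<phi> 1} = topspace X - e" "\<phi> 0 \<in> A"
    using s by (auto simp: split_by_def)
  note c = charmap[OF e AB(1)]
  interpret pendant_edge X V A \<phi> by (rule leaf_pendant_edge[OF e s])
  have AX: "A \<subseteq> topspace X" using AB(4) by blast
  then have tA: "topspace (subtopology X A) = A" by auto
  have edge_in_A: "\<phi>' ` {0..1} \<subseteq> A" if e': "e' \<in> E - {e}" and \<phi>': "characteristic_map X V e' \<phi>'" for e' \<phi>'
  proof -
    have e'E: "e' \<in> E" using e' by simp
    note c' = charmap[OF e'E \<phi>']
    have "\<phi>' ` {0..1} \<subseteq> topspace X - e"
      using c'(3,4) edge_subset_complement[OF e e'E] e' cw(2,3) e unfolding c'(6) by blast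
    then have "\<phi>' ` {0..1} \<subseteq> A \<or> \<phi>' ` {0..1} \<subseteq> {\<phi> 1}"
      using connectedin_split_cases[OF s c'(9)] by blast
    moreover have "\<not> \<phi>' ` {0..1} \<subseteq> {\<phi> 1}"
    proof
      assume "\<phi>' ` {0..1} \<subseteq> {\<phi> 1}"
      then have "e' \<subseteq> {\<phi> 1}" using c'(6) by blast
      then have "\<phi> 1 \<in> e'" using edge_ne[OF e'E] by blast
      then show False using c(4) cw(3) e'E by blast
    qed
    ultimately show ?thesis by blast
  qed
  have e'A: "e' \<subseteq> A" if e': "e' \<in> E - {e}" for e'
    using edge_in_A[OF that] charmap(6)[of e'] cw(5)[of e'] that by blast
  have cells: "V \<inter> A \<union> \<Union>(E - {e}) = A"
  proof (intro subset_antisym subsetI)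
    fix x assume "x \<in> A"
    moreover from this have "x \<in> V \<union> \<Union>E" "x \<notin> e"
      using AX AB(4) cw(2) by auto
    ultimately show "x \<in> V \<inter> A \<union> \<Union>(E - {e})" by blast
  qed (use e'A in blast)
  have maps: "\<exists>\<phi>'. characteristic_map (subtopology X A) (V \<inter> A) e' \<phi>'" if e': "e' \<in> E - {e}" for e'
  proof -
    obtain \<phi>' where \<phi>': "characteristic_map X V e' \<phi>'" using cw(5) e' by blast
    have "subtopology (subtopology X A) e' = subtopology X e'"
      using e'A[OF e'] by (simp add: subtopology_subtopology inf_absorb2)
    then have "characteristic_map (subtopology X A) (V \<inter> A) e' \<phi>'"
      using \<phi>' edge_in_A[OF e' \<phi>'] unfolding characteristic_map_def
      by (auto simp: continuous_map_in_subtopology)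
    then show ?thesis by blast
  qed
  have weak: "closedin (subtopology X A) S"
    if S: "S \<subseteq> A" "\<forall>e'\<in>E - {e}. closedin (subtopology X A) (S \<inter> (subtopology X A) closure_of e')" for S
  proof -
    have "closedin X S"
    proof (rule cw(6))
      show "S \<subseteq> topspace X" using S AX by blast
      fix e' assume e': "e' \<in> E"
      show "closedin X (S \<inter> X closure_of e')"
      proof (cases "e' = e")
        case True
        have "S \<inter> X closure_of e \<subseteq> {\<phi> 0, \<phi> 1}"
          using c(8) S(1) AB(4) by blast
        then show ?thesis
          using cw(1) finite_subset True S(1) AX by (intro closedin_Hausdorff_finite) auto
      next
        case False
        then have "closedin X (S \<inter> (subtopology X A) closure_of e')"
          using S(2) e' AB(2) closedin_closed_subtopology by blast
        moreover have "(subtopology X A) closure_of e' = A \<inter> X closure_of e'"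
          using e'A[of e'] e' False by (simp add: closure_of_subtopology Int_absorb1)
        ultimately show ?thesis using S(1) by (simp add: Int_absorb2 Int_assoc[symmetric])
      qed
    qed
    then show ?thesis using S(1) AB(2) closedin_closed_subtopology by blast
  qed
  have contractible: "contractible_space (subtopology X A)"
  proof -
    have "continuous_map X X (\<lambda>x. slide x 0)"
      using continuous_slide[OF continuous_map_id, of "\<lambda>_. 0"] by simp
    then have "retraction_map X (subtopology X A) (\<lambda>x. slide x 0)"
      unfolding retraction_map_def retraction_maps_def using AX AB(5)
      by (intro exI[of _ id]) (auto simp: continuous_map_in_subtopology slide_def)
    then show ?thesis using contractible_space_retraction_map_image contr by blast
  qed
  have "connected_space (subtopology X A)"
    using split_by_connected[OF e s] by (simp add: connectedin_def)
  moreover have "compact_space (subtopology X A)"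
    using AB(2) cw(7) closedin_compact_space compact_space_subtopology by blast
  moreover have "pairwise disjnt (E - {e})" using cw(4) by (rule pairwise_subset) auto
  moreover have "V \<inter> A \<inter> \<Union>(E - {e}) = {}" using cw(3) by blast
  moreover have "Hausdorff_space (subtopology X A)" using cw(1) Hausdorff_space_subtopology by blast
  moreover have "A \<noteq> {}" using AB(5) by blast
  ultimately show ?thesis
    unfolding CW_tree_def CW_graph_def CW_complex_1_def tA
    using contractible cells maps weak by simp
qed

end

section \<open>Ranks\<close>

text \<open>
  The rank of the homology in degree \<open>p\<close> of the configuration space with labels \<open>I\<close> of a tree with the
  given number of edges. Integer degrees let degree \<open>-1\<close> occur in the recursion; there the rank is \<open>0\<close>.
\<close>
fun conf_rank :: "nat \<Rightarrow> nat set \<Rightarrow> int \<Rightarrow> nat" where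
  "conf_rank 0 I p = (if p = 0 then 1 else 0)"
| "conf_rank (Suc m) I p = conf_rank m I p + (\<Sum>(i, T)\<in>handles I. conf_rank m (I - T - {i}) (p - 1))"

lemma card_handle_complement:
  assumes "finite I" "(i, T) \<in> handles I"
  shows "card (I - T - {i}) + 2 \<le> card I"
proof -
  obtain j where j: "j \<in> T" "j < i" "i \<in> I" "T \<subseteq> I - {i}"
    using assms(2) by (auto simp: handles_def)
  then have "I - T - {i} \<subseteq> I - {i, j}" "card {i, j} = 2" "{i, j} \<subseteq> I"
    by auto
  then show ?thesis
    using assms(1) card_mono[of "I - {i, j}" "I - T - {i}"] card_Diff_subset[of "{i, j}" I] card_mono[of I "{i, j}"]
    by auto
qed

lemma handle_with_card:
  assumes "finite I" "2 \<le> card I"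
  obtains i T where "(i, T) \<in> handles I" "card (I - T - {i}) = card I - 2"
proof -
  have "I \<noteq> {}" using assms by auto
  have "Min I \<noteq> Max I"
  proof
    assume "Min I = Max I"
    then have "x = Max I" if "x \<in> I" for x
      using Min_le[OF assms(1) that] Max_ge[OF assms(1) that] by simp
    then have "I \<subseteq> {Max I}" by blast
    from card_mono[OF _ this] show False using assms by simp
  qed
  moreover have "Min I \<le> Max I" using assms(1) \<open>I \<noteq> {}\<close> by (metis Max_ge Min_in)
  ultimately have lt: "Min I < Max I" by simp
  have "Min I \<in> I" "Max I \<in> I" using assms(1) \<open>I \<noteq> {}\<close> by auto
  then have "(Max I, {Min I}) \<in> handles I" "card (I - {Min I} - {Max I}) = card I - 2"
    using lt assms(1) by (auto simp: handles_def)
  then show ?thesis by (rule that)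
qed

text \<open>
  A handle takes away at least two labels while the degree drops by one, and the handle that carries
  the largest label past the smallest one takes away exactly two.
\<close>
lemma conf_rank_pos_iff:
  "finite I \<Longrightarrow> 0 < conf_rank m I (int d) \<longleftrightarrow> d \<le> min (card I div 2) m"
proof (induction m arbitrary: I d)
  case (Suc m)
  have eq: "0 < conf_rank (Suc m) I (int d) \<longleftrightarrow> 0 < conf_rank m I (int d) \<or>
     (\<exists>i T. (i, T) \<in> handles I \<and> 0 < conf_rank m (I - T - {i}) (int d - 1))"
  proof -
    have "0 < (\<Sum>(i, T)\<in>handles I. conf_rank m (I - T - {i}) (int d - 1)) \<longleftrightarrow>
       (\<exists>(i, T)\<in>handles I. 0 < conf_rank m (I - T - {i}) (int d - 1))"
      unfolding neq0_conv[symmetric] by (simp add: sum_eq_0_iff[OF finite_handles[OF Suc.prems]] case_prod_unfold)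
    then show ?thesis by auto
  qed
  show ?case
  proof (cases d)
    case 0
    then show ?thesis unfolding eq using Suc.IH[OF Suc.prems, of 0] by simp
  next
    case (Suc d')
    have IH: "0 < conf_rank m (I - T - {i}) (int d - 1) \<longleftrightarrow> d' \<le> min (card (I - T - {i}) div 2) m" for i T
      using Suc.IH[of "I - T - {i}" d'] Suc.prems Suc by simp
    show ?thesis
    proof
      assume "0 < conf_rank (Suc m) I (int d)"
      then consider "0 < conf_rank m I (int d)" | i T where "(i, T) \<in> handles I" "0 < conf_rank m (I - T - {i}) (int d - 1)"
        unfolding eq by metis
      then show "d \<le> min (card I div 2) (Suc m)"
      proof cases
        case 1
        then show ?thesis using Suc.IH[OF Suc.prems, of d] by simp
      next
        case 2
        then have "d' \<le> card (I - T - {i}) div 2" "d' \<le> m" using IH by auto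
        moreover have "card (I - T - {i}) + 2 \<le> card I"
          by (rule card_handle_complement[OF Suc.prems 2(1)])
        ultimately show ?thesis using Suc by simp
      qed
    next
      assume d: "d \<le> min (card I div 2) (Suc m)"
      then have "2 \<le> card I" using Suc by auto
      then obtain i T where "(i, T) \<in> handles I" "card (I - T - {i}) = card I - 2"
        using handle_with_card[OF Suc.prems] by blast
      moreover from this have "0 < conf_rank m (I - T - {i}) (int d - 1)"
        unfolding IH using d Suc by auto
      ultimately show "0 < conf_rank (Suc m) I (int d)"
        unfolding eq by blast
    qed
  qed
qed auto

lemma conf_Int_topspace: "conf I (subtopology X A) (V \<inter> A) = conf I (subtopology X A) V"
proof -
  let ?P = "product_topology (\<lambda>_. subtopology X A) I"
  have eq: "topspace ?P \<inter> {x. \<forall>i\<in>I. \<forall>j\<in>I. i \<noteq> j \<longrightarrow> x i = x j \<longrightarrow> x i \<in> V \<inter> A} =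
        topspace ?P \<inter> {x. \<forall>i\<in>I. \<forall>j\<in>I. i \<noteq> j \<longrightarrow> x i = x j \<longrightarrow> x i \<in> V}"
    by (auto simp: PiE_iff)
  show ?thesis
    unfolding conf_def by (rule arg_cong[OF eq, of "subtopology ?P", unfolded subtopology_restrict])
qed

text \<open>
  Induction over the number of edges. Without edges the connected graph is a point, and so is the
  configuration space.
\<close>
theorem free_of_rank_homology_conf_tree:
  assumes "CW_tree X V E" "finite I"
  shows "free_of_rank (homology_group p (conf I X V)) (conf_rank (card E) I p)"
  using assms
proof (induction "card E" arbitrary: X V E I p)
  case 0
  interpret graph_space X V E
    using 0 by unfold_locales (simp add: CW_tree_def)
  have "E = {}" using 0 finite_edges by simp
  then have "V = topspace X" using cw(2) by simp
  moreover obtain v where "v \<in> topspace X" using cw(9) by blast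
  ultimately have "V = {v}" "topspace X = {v}"
    using connected_vertices[of V v] cw(8) by (auto simp: connectedin_topspace)
  then have "x \<in> topspace (conf I X V) \<longleftrightarrow> x = (\<lambda>i\<in>I. v)" for x
    by (auto simp: topspace_conf PiE_iff fun_eq_iff extensional_def)
  then have top: "topspace (conf I X V) = {\<lambda>i\<in>I. v}" by blast
  show ?case
  proof (cases "p = 0")
    case True
    then show ?thesis
      using free_of_rank_integer[OF homology_coefficients[OF top]] 0 by simp
  next
    case False
    then show ?thesis
      using free_of_rank_trivial[OF homology_dimension_axiom[OF top False]] 0 by (metis conf_rank.simps(1))
  qed
next
  case (Suc m)
  interpret graph_space X V E
    using Suc.prems by unfold_locales (simp add: CW_tree_def)
  have contr: "contractible_space X" using Suc.prems by (simp add: CW_tree_def)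
  have "E \<noteq> {}" using Suc.hyps(2) by auto
  then obtain e A \<phi> where e: "e \<in> E" and s: "split_by e A {\<phi> 1} \<phi>"
    using leaf_exists[OF contr] by blast
  interpret pendant_edge X V A \<phi> by (rule leaf_pendant_edge[OF e s])
  have tree: "CW_tree (subtopology X A) (V \<inter> A) (E - {e})"
    by (rule leaf_removal_tree[OF contr e s])
  have card: "m = card (E - {e})"
    using Suc.hyps(2) e finite_edges by simp
  have IH: "free_of_rank (homology_group q (conf J (subtopology X A) V)) (conf_rank m J q)" if "J \<subseteq> I" for J q
    using Suc.hyps(1)[OF card tree finite_subset[OF that Suc.prems(2)], of q]
    unfolding conf_Int_topspace card[symmetric] .
  show ?case
    using free_of_rank_homology_conf[where r="conf_rank m", OF Suc.prems(2) IH]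
    unfolding Suc.hyps(2)[symmetric] by simp
qed

theorem theorem4:
  fixes X :: "'a topology" and V :: "'a set" and E :: "'a set set"
    and X' :: "'b topology" and V' :: "'b set" and E' :: "'b set set"
  assumes "CW_tree X V E"
  shows "(\<forall>n i. torsion_free (homology_group (int i) (sink_conf n X V))) \<and>
    (\<forall>n. has_hdim (sink_conf n X V) (min (n div 2) (card E))) \<and>
    (CW_tree X' V' E' \<and> card E' = card E \<longrightarrow>
      (\<forall>n i. homology_group (int i) (sink_conf n X V) \<cong> homology_group (int i) (sink_conf n X' V')))"
proof (intro conjI allI impI)
  have free: "free_of_rank (homology_group (int i) (sink_conf n X V)) (conf_rank (card E) {..<n} (int i))" for n i
    unfolding sink_conf_eq_conf by (rule free_of_rank_homology_conf_tree[OF assms]) simp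
  show "torsion_free (homology_group (int i) (sink_conf n X V))" for n i
    using torsion_free_free_of_rank[OF free] by simp
  show "has_hdim (sink_conf n X V) (min (n div 2) (card E))" for n
  proof -
    have "\<not> trivial_group (homology_group (int i) (sink_conf n X V)) \<longleftrightarrow> i \<le> min (n div 2) (card E)" for i
      using trivial_group_free_of_rank_iff[OF free] conf_rank_pos_iff[of "{..<n}" "card E" i] by simp
    then show ?thesis
      unfolding has_hdim_def by blast
  qed
  show "homology_group (int i) (sink_conf n X V) \<cong> homology_group (int i) (sink_conf n X' V')"
    if "CW_tree X' V' E' \<and> card E' = card E" for n i
  proof -
    have "free_of_rank (homology_group (int i) (sink_conf n X' V')) (conf_rank (card E) {..<n} (int i))"
      unfolding sink_conf_eq_conf using free_of_rank_homology_conf_tree[of X' V' E' "{..<n}" "int i"] that by simp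
    then show ?thesis
      by (intro free_of_rank_unique_iso[OF free]) simp_all
  qed
qed

end
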